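(* Let $C=C_{\{\mathcal{I}_n,\mathcal{J}_n\}}$ be a nice Cantor set which is $(\alpha_n)$-porous for some sequence $(\alpha_n)_{n\ge1}$, $0<\alpha_n<1$, such that $\sum_{n}\alpha_n^p=\infty$ for some $0<p<\infty$. Then there is a doubling measure $\mu$ on $\mathbb{R}$ with $\mu(C)=0$.
   Context: A measure means a Borel regular outer measure; $\mu$ on $\mathbb{R}$ is doubling if there is $c<\infty$ with $0<\mu(B(x,2r))\le c\,\mu(B(x,r))<\infty$ for all $x$, $r>0$. A Cantor construction $\{\mathcal{I}_n,\mathcal{J}_n\}_n$: for each $n\in\mathbb{N}$, $\mathcal{I}_n=\{I_{n,i}\}_i$ is a collection of closed intervals with mutually disjoint interiors and $\mathcal{J}_n=\{J_{n,i}\}_i$ a collection of open intervals with $J_{n,i}\subset I_{n,i}$, such that each $I_{n+1,i}$ is contained in some $I_{n,j}$, $\bigcup\mathcal{I}_{n+1}=\bigcup\mathcal{I}_n\setminus\bigcup\mathcal{J}_n$, $\sup_j|I_{n,j}|\to0$, and $\bigcup\mathcal{I}_1$ is bounded; $C=\bigcap_n\bigcup_iI_{n,i}$. Nice: there is $0<c<1$ with $cI_{n,i}\cap J_{n,i}\neq\emptyset$ for all $n,i$ ($cI$ the interval concentric with $I$ of length $c|I|$). $(\alpha_n)$-porous: $|J_{n,i}|\ge\alpha_n|I_{n,i}|$ for all $n,i$. *)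

theory Defs
  imports "HOL-Analysis.Analysis"
begin

definition Icl :: "(nat \<Rightarrow> 'i \<Rightarrow> real) \<Rightarrow> (nat \<Rightarrow> 'i \<Rightarrow> real) \<Rightarrow> nat \<Rightarrow> 'i \<Rightarrow> real set" where
  "Icl a b n i = {a n i .. b n i}"

definition Jop :: "(nat \<Rightarrow> 'i \<Rightarrow> real) \<Rightarrow> (nat \<Rightarrow> 'i \<Rightarrow> real) \<Rightarrow> nat \<Rightarrow> 'i \<Rightarrow> real set" where
  "Jop l r n i = {l n i <..< r n i}"

definition cantor_construction ::
  "(nat \<Rightarrow> 'i set) \<Rightarrow> (nat \<Rightarrow> 'i \<Rightarrow> real) \<Rightarrow> (nat \<Rightarrow> 'i \<Rightarrow> real) \<Rightarrow>
   (nat \<Rightarrow> 'i \<Rightarrow> real) \<Rightarrow> (nat \<Rightarrow> 'i \<Rightarrow> real) \<Rightarrow> bool" where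
  "cantor_construction K a b l r \<longleftrightarrow>
     (\<forall>n\<ge>1. \<forall>i\<in>K n. a n i \<le> b n i) \<and>
     (\<forall>n\<ge>1. \<forall>i\<in>K n. \<forall>j\<in>K n. i \<noteq> j \<longrightarrow>
         interior (Icl a b n i) \<inter> interior (Icl a b n j) = {}) \<and>
     (\<forall>n\<ge>1. \<forall>i\<in>K n. Jop l r n i \<subseteq> Icl a b n i) \<and>
     (\<forall>n\<ge>1. \<forall>i\<in>K (Suc n). \<exists>j\<in>K n. Icl a b (Suc n) i \<subseteq> Icl a b n j) \<and>
     (\<forall>n\<ge>1. (\<Union>i\<in>K (Suc n). Icl a b (Suc n) i) =
              (\<Union>i\<in>K n. Icl a b n i) - (\<Union>i\<in>K n. Jop l r n i)) \<and>
     (\<forall>\<epsilon>>0. \<exists>N. \<forall>n\<ge>N. \<forall>j\<in>K n. b n j - a n j \<le> \<epsilon>) \<and>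
     bounded (\<Union>i\<in>K 1. Icl a b 1 i)"

definition cantor_set ::
  "(nat \<Rightarrow> 'i set) \<Rightarrow> (nat \<Rightarrow> 'i \<Rightarrow> real) \<Rightarrow> (nat \<Rightarrow> 'i \<Rightarrow> real) \<Rightarrow> real set" where
  "cantor_set K a b = (\<Inter>n\<in>{1..}. \<Union>i\<in>K n. Icl a b n i)"

definition nice_construction ::
  "(nat \<Rightarrow> 'i set) \<Rightarrow> (nat \<Rightarrow> 'i \<Rightarrow> real) \<Rightarrow> (nat \<Rightarrow> 'i \<Rightarrow> real) \<Rightarrow>
   (nat \<Rightarrow> 'i \<Rightarrow> real) \<Rightarrow> (nat \<Rightarrow> 'i \<Rightarrow> real) \<Rightarrow> bool" where
  "nice_construction K a b l r \<longleftrightarrow>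
     (\<exists>c::real. 0 < c \<and> c < 1 \<and>
        (\<forall>n\<ge>1. \<forall>i\<in>K n.
           {(a n i + b n i) / 2 - c * (b n i - a n i) / 2 ..
            (a n i + b n i) / 2 + c * (b n i - a n i) / 2} \<inter> Jop l r n i \<noteq> {}))"

definition porous_construction ::
  "(nat \<Rightarrow> real) \<Rightarrow> (nat \<Rightarrow> 'i set) \<Rightarrow> (nat \<Rightarrow> 'i \<Rightarrow> real) \<Rightarrow> (nat \<Rightarrow> 'i \<Rightarrow> real) \<Rightarrow>
   (nat \<Rightarrow> 'i \<Rightarrow> real) \<Rightarrow> (nat \<Rightarrow> 'i \<Rightarrow> real) \<Rightarrow> bool" where
  "porous_construction \<alpha> K a b l r \<longleftrightarrow>
     (\<forall>n\<ge>1. \<forall>i\<in>K n. r n i - l n i \<ge> \<alpha> n * (b n i - a n i))"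

definition doubling_measure :: "real measure \<Rightarrow> bool" where
  "doubling_measure \<mu> \<longleftrightarrow> sets \<mu> = sets borel \<and>
     (\<exists>c::real. \<forall>x r. r > 0 \<longrightarrow>
        0 < emeasure \<mu> (ball x (2 * r)) \<and>
        emeasure \<mu> (ball x (2 * r)) \<le> ennreal c * emeasure \<mu> (ball x r) \<and>
        emeasure \<mu> (ball x r) < \<infinity>)"

end

theory Submission
  imports Defs
begin

text \<open>
  For \<open>p < 1\<close> (which may be assumed, as \<open>\<alpha> n < 1\<close>) the measure is built by its distribution function. Starting
  from the identity, one generation after another, a short interval concentrated around a point \<open>z\<close> of the
  hole \<open>J\<close> of every \<open>I\<close> is warped by a map with derivative comparable to \<open>(\<bar>x - z\<bar> / d) powr (p - 1)\<close>, with
  \<open>d\<close> a small multiple of \<open>\<bar>I\<bar>\<close>; this gives the hole at least a fixed multiple of \<open>\<alpha> n powr p\<close> of the mass of \<open>I\<close>.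
  Niceness makes the lengths decrease geometrically, so passing to a residue class of generations (which keeps the
  series divergent) makes every interval as short as desired compared with its parent. A warping centre never lies
  inside a later interval, so where a later warping takes place the earlier ones have nearly constant derivative:
  their distortions form a geometric series, and at each scale at most one centre matters. Hence the distribution
  functions are quasisymmetric with a uniform constant, their limit defines a doubling measure, and the mass of
  the \<open>n\<close>-th generation is at most a constant times \<open>exp (- c * (\<Sum>k<n. \<alpha> k powr p))\<close>.
\<close>

subsection \<open>The warping map\<close>

text \<open>The factor \<open>p + (1 - p) * (t / D)\<close> makes the profile continuously differentiable at \<open>t = D\<close>.\<close>

definition prof :: "real \<Rightarrow> real \<Rightarrow> real \<Rightarrow> real" where
  "prof p D t = (if t \<le> D then D * ((t / D) powr p * (p + (1 - p) * (t / D))) else t)"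

text \<open>Derivative of the profile in the rescaled variable \<open>t / D\<close>, obtained from
  \<open>s powr p * (p + (1 - p) * s)\<close>. The coefficients add up to 1, which is the slope of
  the identity joined at \<open>s = 1\<close>.\<close>

definition slope :: "real \<Rightarrow> real \<Rightarrow> real" where
  "slope p t = (if t \<le> 1 then p\<^sup>2 * t powr (p - 1) + (1 - p\<^sup>2) * t powr p else 1)"

section \<open>Derivative of the profile and variation of its slope\<close>

lemma prof_0 [simp]: "prof p D 0 = 0"
  by (simp add: prof_def)

lemma prof_ge: "0 < D \<Longrightarrow> D \<le> t \<Longrightarrow> prof p D t = t"
  by (auto simp: prof_def)

lemma has_real_derivative_prof:
  assumes "0 < D" "0 < t"
  shows "(prof p D has_real_derivative slope p (t / D)) (at t)"
proof -
  define h where "h = (\<lambda>t. D * ((t / D) powr p * (p + (1 - p) * (t / D))))"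
  have h: "(h has_real_derivative p\<^sup>2 * (t / D) powr (p - 1) + (1 - p\<^sup>2) * (t / D) powr p) (at t)"
  proof -
    have e: "(t / D) powr p = (t / D) powr (p - 1) * (t / D)"
      using assms by (simp add: powr_diff)
    have "(h has_real_derivative D * ((p * (t / D) powr (p - 1) * (1 / D)) * (p + (1 - p) * (t / D))
            + (t / D) powr p * ((1 - p) * (1 / D)))) (at t)"
      unfolding h_def using assms
      by (auto intro!: derivative_eq_intros simp: field_simps powr_diff)
    moreover have "D * ((p * (t / D) powr (p - 1) * (1 / D)) * (p + (1 - p) * (t / D))
            + (t / D) powr p * ((1 - p) * (1 / D)))
         = p\<^sup>2 * (t / D) powr (p - 1) + (1 - p\<^sup>2) * (t / D) powr p"
      unfolding e using assms by (simp add: field_simps power2_eq_square)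
    ultimately show ?thesis by simp
  qed
  consider "t < D" | "t = D" | "D < t" by linarith
  then show ?thesis
  proof cases
    case 1
    have "(prof p D has_real_derivative p\<^sup>2 * (t / D) powr (p - 1) + (1 - p\<^sup>2) * (t / D) powr p) (at t)"
      by (rule has_field_derivative_transform_within_open[OF h, of "{..<D}"])
        (use 1 in \<open>auto simp: h_def prof_def\<close>)
    then show ?thesis using 1 assms by (simp add: slope_def)
  next
    case 3
    have "(prof p D has_real_derivative 1) (at t)"
      by (rule has_field_derivative_transform_within_open[OF DERIV_ident, of "{D<..}"])
        (use 3 in \<open>auto simp: prof_def\<close>)
    then show ?thesis using 3 assms by (simp add: slope_def)
  next
    \<comment> \<open>At the joint the two formulas have one-sided derivatives with the common value
      1, which are glued together.\<close>
    case 2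
    have 1: "(h has_real_derivative 1) (at D)"
      using h assms 2 by simp
    have "(prof p D has_real_derivative 1) (at D within {..D})"
      by (rule has_field_derivative_transform_within[OF has_field_derivative_at_within[OF 1], of 1])
        (auto simp: h_def prof_def)
    then have "(prof p D has_real_derivative 1) (at D within {..<D})"
      by (rule has_field_derivative_subset) auto
    moreover have "(prof p D has_real_derivative 1) (at D within {D..})"
      by (rule has_field_derivative_transform_within[OF DERIV_ident, of 1])
        (use assms in \<open>auto simp: prof_def\<close>)
    then have "(prof p D has_real_derivative 1) (at D within {D<..})"
      by (rule has_field_derivative_subset) auto
    ultimately have "(prof p D has_real_derivative 1) (at D)"
      unfolding has_field_derivative_iff by (rule filterlim_split_at)
    then show ?thesis using 2 assms by (simp add: slope_def)
  qed
qed

text \<open>After multiplication by \<open>t\<close> the two powers have the positive exponents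
  \<open>p\<close> and \<open>p + 1\<close>, hence increase; past 1 the product is \<open>t\<close>
  itself.\<close>

lemma slope_times_mono:
  assumes "0 < p" "p < 1" "0 < s" "s \<le> t"
  shows "slope p s * s \<le> slope p t * t"
proof -
  have q: "p\<^sup>2 \<le> 1" using assms by (simp add: power_le_one)
  have e: "slope p x * x = p\<^sup>2 * x powr p + (1 - p\<^sup>2) * (x powr p * x)" if "0 < x" "x \<le> 1" for x
    using that by (simp add: slope_def powr_diff field_simps)
  have i: "p\<^sup>2 * x powr p + (1 - p\<^sup>2) * (x powr p * x) \<le> p\<^sup>2 * y powr p + (1 - p\<^sup>2) * (y powr p * y)"
    if "0 < x" "x \<le> y" for x y
    using that assms q by (intro add_mono mult_left_mono mult_mono powr_mono2) auto
  show ?thesis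
  proof (cases "t \<le> 1")
    case True
    then show ?thesis using assms e[of s] e[of t] i[of s t] by simp
  next
    case False
    then have t: "slope p t * t = t" by (simp add: slope_def)
    show ?thesis
    proof (cases "s \<le> 1")
      case True
      then show ?thesis using assms e[of s] i[of s 1] t False by simp
    next
      case False
      then show ?thesis using assms by (simp add: slope_def)
    qed
  qed
qed

text \<open>Division by \<open>t\<close> makes the exponents \<open>p - 2\<close> and
  \<open>p - 1\<close>, both negative; past 1 the quotient is \<open>1 / t\<close>.\<close>

lemma slope_divide_antimono:
  assumes "0 < p" "p < 1" "0 < s" "s \<le> t"
  shows "slope p t * s \<le> slope p s * t"
proof -
  have q: "p\<^sup>2 \<le> 1" using assms by (simp add: power_le_one)
  have e: "slope p x / x = p\<^sup>2 * x powr (p - 2) + (1 - p\<^sup>2) * x powr (p - 1)" if "0 < x" "x \<le> 1" for x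
    using that by (simp add: slope_def powr_diff field_simps power2_eq_square)
  have i: "p\<^sup>2 * y powr (p - 2) + (1 - p\<^sup>2) * y powr (p - 1) \<le> p\<^sup>2 * x powr (p - 2) + (1 - p\<^sup>2) * x powr (p - 1)"
    if "0 < x" "x \<le> y" for x y
    using that assms q by (intro add_mono mult_left_mono powr_mono2') auto
  have "slope p t / t \<le> slope p s / s"
  proof (cases "t \<le> 1")
    case True
    then show ?thesis using assms e[of s] e[of t] i[of s t] by simp
  next
    case False
    then have t: "slope p t / t = 1 / t" by (simp add: slope_def)
    show ?thesis
    proof (cases "s \<le> 1")
      case True
      have "1 / t \<le> 1" using False by simp
      also have "1 \<le> slope p s / s" using True assms e[of s] i[of s 1] by simp
      finally show ?thesis unfolding t .
    next
      case False
      then show ?thesis using assms by (simp add: slope_def frac_le)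
    qed
  qed
  then show ?thesis using assms by (simp add: field_simps)
qed

lemma slope_pos:
  assumes "0 < p" "p < 1" "0 < t"
  shows "0 < slope p t"
proof -
  have "p\<^sup>2 < 1" using assms by (simp add: power_less_one_iff)
  then show ?thesis using assms by (auto simp: slope_def intro!: add_pos_nonneg)
qed

text \<open>The first monotonicity fact serves for \<open>s \<le> t\<close>, the second otherwise.
  The ratio \<open>n / m\<close> is free of \<open>p\<close> and close to 1 on intervals short
  compared with their distance from the centre, which keeps the accumulated distortion
  bounded.\<close>

lemma slope_ratio:
  assumes "0 < p" "p < 1" "0 < m" "m \<le> s" "m \<le> t" "s \<le> n" "t \<le> n"
  shows "slope p s * m \<le> n * slope p t"
proof -
  have pos: "0 < slope p s" "0 < slope p t" using assms by (auto intro!: slope_pos)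
  show ?thesis
  proof (cases "s \<le> t")
    case True
    have "slope p s * m \<le> slope p s * s" using pos assms by (intro mult_left_mono) auto
    also have "\<dots> \<le> slope p t * t" using True assms by (intro slope_times_mono) auto
    also have "\<dots> \<le> slope p t * n" using pos assms by (intro mult_left_mono) auto
    finally show ?thesis by (simp add: mult.commute)
  next
    case False
    have "slope p s * m \<le> slope p s * t" using pos assms by (intro mult_left_mono) auto
    also have "\<dots> \<le> slope p t * s" using False assms by (intro slope_divide_antimono) auto
    also have "\<dots> \<le> slope p t * n" using pos assms by (intro mult_left_mono) auto
    finally show ?thesis by (simp add: mult.commute)
  qed
qed

lemma prof_mvt:
  assumes "0 < D" "0 < s" "s < t"
  obtains \<xi> where "s < \<xi>" "\<xi> < t" "prof p D t - prof p D s = (t - s) * slope p (\<xi> / D)"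
  using MVT2[of s t "prof p D" "\<lambda>x. slope p (x / D)"] has_real_derivative_prof[OF assms(1), of _ p] assms
  by (metis less_le_trans)

lemma prof_quotient_ratio:
  assumes p: "0 < p" "p < 1" and "0 < D" "0 < m"
    and "m \<le> s" "s < t" "t \<le> n" "m \<le> s'" "s' < t'" "t' \<le> n"
  shows "(prof p D t - prof p D s) * (t' - s') * m \<le> n * (prof p D t' - prof p D s') * (t - s)"
proof -
  obtain x where x: "s < x" "x < t" "prof p D t - prof p D s = (t - s) * slope p (x / D)"
    using prof_mvt[of D s t p] assms by auto
  obtain y where y: "s' < y" "y < t'" "prof p D t' - prof p D s' = (t' - s') * slope p (y / D)"
    using prof_mvt[of D s' t' p] assms by auto
  have "slope p (x / D) * (m / D) \<le> (n / D) * slope p (y / D)"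
    by (rule slope_ratio) (use assms x y in \<open>auto simp: divide_right_mono\<close>)
  then have "slope p (x / D) * m \<le> n * slope p (y / D)"
    using assms by (simp add: field_simps)
  then have "((t - s) * (t' - s')) * (slope p (x / D) * m) \<le> ((t - s) * (t' - s')) * (n * slope p (y / D))"
    using assms by (intro mult_left_mono) auto
  then show ?thesis unfolding x(3) y(3) by (simp add: algebra_simps)
qed

text \<open>Order of magnitude of the slope at distance \<open>t\<close> from the centre:
  \<open>t * env p D t\<close> bounds the profile from above, \<open>p\<^sup>2 * env p D t\<close>
  bounds its slope from below.\<close>

definition env :: "real \<Rightarrow> real \<Rightarrow> real \<Rightarrow> real" where
  "env p D t = max 1 ((D / t) powr (1 - p))"

lemma env_ge_1: "1 \<le> env p D t"
  by (simp add: env_def)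

lemma env_antimono:
  assumes "p < 1" "0 < D" "0 < s" "s \<le> t"
  shows "env p D t \<le> env p D s"
proof -
  have "(D / t) powr (1 - p) \<le> (D / s) powr (1 - p)"
    using assms by (intro powr_mono2) (auto simp: frac_le)
  then show ?thesis by (simp add: env_def)
qed

text \<open>A factor 2 between the radii costs at most \<open>2 powr (1 - p) \<le> 2\<close>. This
  makes the two sides of a nearly balanced warp comparable.\<close>

lemma env_le_twice:
  assumes "0 < p" "p < 1" "0 < D" "0 < t" "0 < D'" "D \<le> 2 * D'"
  shows "env p D t \<le> 2 * env p D' t"
proof -
  have "(D / t) powr (1 - p) \<le> (2 * (D' / t)) powr (1 - p)"
    using assms by (intro powr_mono2) (auto simp: field_simps)
  also have "\<dots> = 2 powr (1 - p) * (D' / t) powr (1 - p)"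
    by (rule powr_mult)
  also have "\<dots> \<le> 2 powr 1 * (D' / t) powr (1 - p)"
    using assms by (intro mult_right_mono powr_mono) auto
  finally show ?thesis by (auto simp: env_def max_def)
qed

lemma prof_inner:
  assumes "0 < t" "t \<le> D"
  shows "prof p D t = t * (D / t) powr (1 - p) * (p + (1 - p) * (t / D))"
proof -
  have "D * (t / D) powr p = t * (D / t) powr (1 - p)"
    using assms by (simp add: powr_divide powr_diff field_simps)
  then show ?thesis using assms by (simp add: prof_def)
qed

lemma prof_le:
  assumes "0 < p" "p < 1" "0 < D" "0 < t"
  shows "prof p D t \<le> t * env p D t"
proof (cases "t \<le> D")
  case True
  have "(1 - p) * (t / D) \<le> (1 - p) * 1" using assms True by (intro mult_left_mono) auto
  then have "t * (D / t) powr (1 - p) * (p + (1 - p) * (t / D)) \<le> t * (D / t) powr (1 - p) * 1"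
    using assms by (intro mult_left_mono) auto
  also have "\<dots> \<le> t * env p D t" using assms by (simp add: env_def)
  finally show ?thesis using prof_inner[of t D p] assms True by simp
next
  case False
  then show ?thesis using assms env_ge_1[of p D t] by (simp add: prof_def)
qed

lemma slope_ge:
  assumes "0 < p" "p < 1" "0 < D" "0 < t"
  shows "p\<^sup>2 * env p D t \<le> slope p (t / D)"
proof (cases "t \<le> D")
  case True
  have "1 \<le> (D / t) powr (1 - p)" using assms True by (intro ge_one_powr_ge_zero) auto
  moreover have "(t / D) powr (p - 1) = (D / t) powr (1 - p)"
    using assms by (simp add: powr_divide powr_diff field_simps)
  moreover have "p\<^sup>2 \<le> 1" using assms by (simp add: power_le_one)
  ultimately show ?thesis using assms True by (simp add: env_def slope_def)
next
  case False
  have "(D / t) powr (1 - p) \<le> 1 powr (1 - p)" using assms False by (intro powr_mono2) auto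
  moreover have "p\<^sup>2 \<le> 1" using assms by (simp add: power_le_one)
  ultimately show ?thesis using assms False by (simp add: env_def slope_def)
qed

lemma prof_ge_power:
  assumes "0 < p" "p < 1" "0 < t" "t \<le> D"
  shows "p * (t / D) powr p * D \<le> prof p D t"
proof -
  have "D * ((t / D) powr p * p) \<le> D * ((t / D) powr p * (p + (1 - p) * (t / D)))"
    using assms by (intro mult_left_mono) auto
  then show ?thesis using assms by (simp add: prof_def algebra_simps)
qed

text \<open>\<open>env\<close> decreases with the distance, so its value at \<open>r\<close> bounds
  the slope from below up to \<open>r\<close>. An interval starting at 0 is handled by the explicit
  formula, as \<open>prof_mvt\<close> asks for \<open>0 < s\<close>.\<close>

lemma prof_diff_ge:
  assumes p: "0 < p" "p < 1" and "0 < D" "0 \<le> s" "s \<le> t" "t \<le> r" "0 < r"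
  shows "p\<^sup>2 * env p D r * (t - s) \<le> prof p D t - prof p D s"
proof -
  consider "s = t" | "s < t" "s = 0" | "s < t" "0 < s" using assms by linarith
  then show ?thesis
  proof cases
    case 2
    have pp: "p\<^sup>2 \<le> p" using p by (simp add: power2_eq_square mult_left_le)
    have "p\<^sup>2 * env p D r * t \<le> p\<^sup>2 * env p D t * t"
      using assms 2 by (intro mult_right_mono mult_left_mono env_antimono) auto
    also have "\<dots> \<le> prof p D t"
    proof (cases "t \<le> D")
      case True
      have "1 \<le> (D / t) powr (1 - p)" using assms True 2 by (intro ge_one_powr_ge_zero) auto
      then have "p\<^sup>2 * env p D t * t = p\<^sup>2 * (t * (D / t) powr (1 - p))"
        by (simp add: env_def)
      also have "\<dots> \<le> (p + (1 - p) * (t / D)) * (t * (D / t) powr (1 - p))"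
        using assms 2 pp by (intro mult_right_mono) (auto intro: add_increasing2)
      finally show ?thesis using prof_inner[of t D p] True 2 by (simp add: mult.commute)
    next
      case False
      have "(D / t) powr (1 - p) \<le> 1 powr (1 - p)" using assms False 2 by (intro powr_mono2) auto
      then show ?thesis using False assms pp 2 by (simp add: env_def prof_def mult_left_le_one_le)
    qed
    finally show ?thesis using 2 by simp
  next
    case 3
    then obtain x where x: "s < x" "x < t" "prof p D t - prof p D s = (t - s) * slope p (x / D)"
      using prof_mvt[of D s t p] assms by auto
    have "p\<^sup>2 * env p D r \<le> p\<^sup>2 * env p D x"
      using assms x 3 by (intro mult_left_mono env_antimono) auto
    also have "\<dots> \<le> slope p (x / D)" using assms x 3 by (intro slope_ge) auto
    finally show ?thesis unfolding x(3) using 3 by (simp add: mult.commute mult_left_mono)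
  qed auto
qed

text \<open>The ends \<open>u\<close>, \<open>v\<close> of the warped interval may lie at different
  distances from the centre \<open>c\<close>, because all three will be images of points under the
  preceding map.\<close>

definition warp :: "real \<Rightarrow> real \<Rightarrow> real \<Rightarrow> real \<Rightarrow> real \<Rightarrow> real" where
  "warp p u c v y = (if c \<le> y then c + prof p (v - c) (y - c) else c - prof p (c - u) (c - y))"

text \<open>Reflection exchanges the two branches, so estimates to the right of the centre carry
  over to the left.\<close>

lemma warp_minus: "warp p u c v y = - warp p (- v) (- c) (- u) (- y)"
  by (auto simp: warp_def)

lemma warp_center [simp]: "warp p u c v c = c"
  by (simp add: warp_def)

lemma warp_outside: "u < c \<Longrightarrow> c < v \<Longrightarrow> y \<le> u \<or> v \<le> y \<Longrightarrow> warp p u c v y = y"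
  by (auto simp: warp_def prof_ge)

lemma warp_diff_ge:
  assumes p: "0 < p" "p < 1" and uv: "u < c" "c < v" and "x \<le> y"
    and r: "\<bar>x - c\<bar> \<le> r" "\<bar>y - c\<bar> \<le> r" "0 < r"
    and E: "E \<le> env p (v - c) r" "E \<le> env p (c - u) r"
  shows "p\<^sup>2 * E * (y - x) \<le> warp p u c v y - warp p u c v x"
proof -
  have le: "p\<^sup>2 * E * d \<le> p\<^sup>2 * env p D r * d" if "E \<le> env p D r" "0 \<le> d" for d D
    using that by (intro mult_right_mono mult_left_mono) auto
  consider "c \<le> x" | "x < c" "c \<le> y" | "y < c" by linarith
  then show ?thesis
  proof cases
    case 1
    have "p\<^sup>2 * env p (v - c) r * ((y - c) - (x - c)) \<le> prof p (v - c) (y - c) - prof p (v - c) (x - c)"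
      using assms 1 by (intro prof_diff_ge) auto
    then show ?thesis using 1 \<open>x \<le> y\<close> order_trans[OF le[OF E(1), of "y - x"]] by (simp add: warp_def)
  next
    case 2
    have "p\<^sup>2 * env p (v - c) r * ((y - c) - 0) \<le> prof p (v - c) (y - c) - prof p (v - c) 0"
      using assms 2 by (intro prof_diff_ge) auto
    moreover have "p\<^sup>2 * env p (c - u) r * ((c - x) - 0) \<le> prof p (c - u) (c - x) - prof p (c - u) 0"
      using assms 2 by (intro prof_diff_ge) auto
    moreover have "p\<^sup>2 * E * (y - x) = p\<^sup>2 * E * (y - c) + p\<^sup>2 * E * (c - x)"
      by (simp add: algebra_simps)
    ultimately show ?thesis using 2 le[OF E(1), of "y - c"] le[OF E(2), of "c - x"]
      by (simp add: warp_def)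
  next
    case 3
    have "p\<^sup>2 * env p (c - u) r * ((c - x) - (c - y)) \<le> prof p (c - u) (c - x) - prof p (c - u) (c - y)"
      using assms 3 by (intro prof_diff_ge) auto
    then show ?thesis using 3 \<open>x \<le> y\<close> order_trans[OF le[OF E(2), of "y - x"]] by (simp add: warp_def)
  qed
qed

lemma warp_strict_mono:
  assumes "0 < p" "p < 1" "u < c" "c < v" "x < y"
  shows "warp p u c v x < warp p u c v y"
proof -
  define r where "r = max \<bar>x - c\<bar> \<bar>y - c\<bar>"
  have "p\<^sup>2 * 1 * (y - x) \<le> warp p u c v y - warp p u c v x"
    by (rule warp_diff_ge[where r = r]) (use assms env_ge_1 in \<open>auto simp: r_def\<close>)
  moreover have "0 < p\<^sup>2 * 1 * (y - x)" using assms by simp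
  ultimately show ?thesis by linarith
qed

lemma warp_mono:
  assumes "0 < p" "p < 1" "u < c" "c < v" "x \<le> y"
  shows "warp p u c v x \<le> warp p u c v y"
  using warp_strict_mono[OF assms(1-4), of x y] assms(5) by (cases "x = y") auto

lemma warp_quotient_ratio:
  assumes p: "0 < p" "p < 1" and uv: "u < c" "c < v" and "c < m"
    and "m \<le> x" "x < y" "y \<le> n" "m \<le> x'" "x' < y'" "y' \<le> n"
  shows "(warp p u c v y - warp p u c v x) * (y' - x') * (m - c)
    \<le> (n - c) * (warp p u c v y' - warp p u c v x') * (y - x)"
  using prof_quotient_ratio[of p "v - c" "m - c" "x - c" "y - c" "n - c" "x' - c" "y' - c"] assms
  by (simp add: warp_def)

lemma warp_quotient_ratio_left:
  assumes p: "0 < p" "p < 1" and uv: "u < c" "c < v" and "m < c"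
    and "n \<le> x" "x < y" "y \<le> m" "n \<le> x'" "x' < y'" "y' \<le> m"
  shows "(warp p u c v y - warp p u c v x) * (y' - x') * (c - m)
    \<le> (c - n) * (warp p u c v y' - warp p u c v x') * (y - x)"
  using warp_quotient_ratio[of p "- v" "- c" "- u" "- m" "- y" "- x" "- n" "- y'" "- x'"] assms
  by (simp add: warp_minus[of p u c v])

text \<open>At distance at least the length \<open>l\<close> from the centre, slopes vary by a
  factor of at most 2. Otherwise both intervals lie in \<open>[c - 2 * l, c + 2 * l]\<close>, whose
  image has length at most \<open>6 * E * l\<close>, while every subinterval is stretched at least
  by \<open>p\<^sup>2 * E\<close>.\<close>

lemma warp_quasisymmetric:
  assumes p: "0 < p" "p < 1" and uv: "u < c" "c < v" and bal: "c - u \<le> 2 * (v - c)" "v - c \<le> 2 * (c - u)"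
    and sub: "x1 \<le> y1" "y1 < y2" "y2 \<le> x2" and \<epsilon>: "0 < \<epsilon>" "\<epsilon> * (x2 - x1) \<le> y2 - y1"
  shows "warp p u c v x2 - warp p u c v x1 \<le> 6 / (p\<^sup>2 * \<epsilon>) * (warp p u c v y2 - warp p u c v y1)"
proof -
  define l where "l = x2 - x1"
  define W where "W = warp p u c v"
  have l: "0 < l" using sub by (simp add: l_def)
  have "p\<^sup>2 \<le> 1" using p by (simp add: power_le_one)
  have Wy: "0 < W y2 - W y1" using warp_strict_mono[OF p uv sub(2)] by (simp add: W_def)
  \<comment> \<open>Common end of both far cases: the distances from the centre range over
    \<open>[m, n]\<close>.\<close>
  have far: "W x2 - W x1 \<le> 6 / (p\<^sup>2 * \<epsilon>) * (W y2 - W y1)"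
    if "(W x2 - W x1) * (y2 - y1) * m \<le> n * (W y2 - W y1) * (x2 - x1)" "0 < m" "n \<le> 2 * m" for m n
  proof -
    have Wx: "0 \<le> W x2 - W x1" using warp_mono[OF p uv, of x1 x2] sub by (simp add: W_def)
    have "(W x2 - W x1) * (\<epsilon> * l) * m \<le> (W x2 - W x1) * (y2 - y1) * m"
      using Wx that \<epsilon> by (intro mult_right_mono mult_left_mono) (auto simp: l_def)
    also have "\<dots> \<le> n * (W y2 - W y1) * l" using that by (simp add: l_def)
    also have "\<dots> \<le> (2 * m) * (W y2 - W y1) * l" using that Wy l by (intro mult_right_mono) auto
    finally have "(l * m) * ((W x2 - W x1) * \<epsilon>) \<le> (l * m) * (2 * (W y2 - W y1))" by (simp add: algebra_simps)
    then have "(W x2 - W x1) * \<epsilon> \<le> 2 * (W y2 - W y1)" using l that by simp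
    then have "W x2 - W x1 \<le> 2 / \<epsilon> * (W y2 - W y1)" using \<epsilon> by (simp add: field_simps)
    also have "\<dots> \<le> 6 / (p\<^sup>2 * \<epsilon>) * (W y2 - W y1)"
      using \<epsilon> p Wy \<open>p\<^sup>2 \<le> 1\<close> by (intro mult_right_mono) (auto simp: field_simps)
    finally show ?thesis .
  qed
  consider "c \<le> x1 - l" | "x2 + l \<le> c" | "x1 - l < c" "c < x2 + l" by linarith
  then have "W x2 - W x1 \<le> 6 / (p\<^sup>2 * \<epsilon>) * (W y2 - W y1)"
  proof cases
    case 1
    show ?thesis
      by (rule far[of "x1 - c" "x2 - c"])
        (use 1 l sub p uv warp_quotient_ratio[of p u c v x1 x1 x2 x2 y1 y2] in \<open>auto simp: W_def l_def\<close>)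
  next
    case 2
    show ?thesis
      by (rule far[of "c - x2" "c - x1"])
        (use 2 l sub p uv warp_quotient_ratio_left[of p u c v x2 x1 x1 x2 y1 y2] in \<open>auto simp: W_def l_def\<close>)
  next
    case 3
    define E where "E = min (env p (v - c) (2 * l)) (env p (c - u) (2 * l))"
    have "1 \<le> E" using env_ge_1 by (simp add: E_def)
    have "env p (v - c) (2 * l) \<le> 2 * env p (c - u) (2 * l)" "env p (c - u) (2 * l) \<le> 2 * env p (v - c) (2 * l)"
      using assms l by (auto intro!: env_le_twice)
    \<comment> \<open>The larger envelope is at most twice the smaller one \<open>E\<close>, hence
      the factor 3.\<close>
    then have sum: "env p (v - c) (2 * l) + env p (c - u) (2 * l) \<le> 3 * E" by (auto simp: E_def min_def)
    have "W x2 - W x1 \<le> W (c + 2 * l) - W (c - 2 * l)"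
      using warp_mono[OF p uv, of x2 "c + 2 * l"] warp_mono[OF p uv, of "c - 2 * l" x1] 3
      by (simp add: W_def l_def)
    also have "\<dots> = prof p (v - c) (2 * l) + prof p (c - u) (2 * l)"
      using l by (simp add: W_def warp_def)
    also have "\<dots> \<le> 2 * l * env p (v - c) (2 * l) + 2 * l * env p (c - u) (2 * l)"
      using p uv l by (intro add_mono prof_le) auto
    also have "\<dots> = 2 * l * (env p (v - c) (2 * l) + env p (c - u) (2 * l))" by (simp add: algebra_simps)
    also have "\<dots> \<le> 2 * l * (3 * E)" using sum l by (intro mult_left_mono) auto
    finally have up: "W x2 - W x1 \<le> 6 * (E * l)" by (simp add: mult.commute)
    have "p\<^sup>2 * E * (\<epsilon> * l) \<le> p\<^sup>2 * E * (y2 - y1)"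
      using \<epsilon> \<open>1 \<le> E\<close> by (intro mult_left_mono) (auto simp: l_def)
    also have "\<dots> \<le> W y2 - W y1"
      unfolding W_def by (rule warp_diff_ge[where r = "2 * l"]) (use p uv sub 3 l in \<open>auto simp: E_def l_def abs_if\<close>)
    finally have "E * l \<le> (W y2 - W y1) / (p\<^sup>2 * \<epsilon>)" using p \<epsilon> by (simp add: field_simps)
    then have "W x2 - W x1 \<le> 6 * ((W y2 - W y1) / (p\<^sup>2 * \<epsilon>))" using up by linarith
    also have "\<dots> = 6 / (p\<^sup>2 * \<epsilon>) * (W y2 - W y1)" by simp
    finally show ?thesis .
  qed
  then show ?thesis by (simp add: W_def)
qed

subsection \<open>Distortion\<close>

text \<open>Bounded ratio of derivatives, put through difference quotients because the maps are not
  differentiable at the warping centres, and cleared of denominators.\<close>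

definition distortion_le :: "real \<Rightarrow> (real \<Rightarrow> real) \<Rightarrow> real \<Rightarrow> real \<Rightarrow> bool" where
  "distortion_le M F u v \<longleftrightarrow> (\<forall>x y x' y'. u \<le> x \<and> x < y \<and> y \<le> v \<and> u \<le> x' \<and> x' < y' \<and> y' \<le> v \<longrightarrow>
     (F y - F x) * (y' - x') \<le> M * (F y' - F x') * (y - x))"

lemma distortion_leD:
  "distortion_le M F u v \<Longrightarrow> u \<le> x \<Longrightarrow> x < y \<Longrightarrow> y \<le> v \<Longrightarrow> u \<le> x' \<Longrightarrow> x' < y' \<Longrightarrow> y' \<le> v \<Longrightarrow>
     (F y - F x) * (y' - x') \<le> M * (F y' - F x') * (y - x)"
  unfolding distortion_le_def by blast

lemma distortion_le_cong:
  assumes "\<And>x. u \<le> x \<Longrightarrow> x \<le> v \<Longrightarrow> F x = G x"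
  shows "distortion_le M F u v \<longleftrightarrow> distortion_le M G u v"
  unfolding distortion_le_def
  by (intro iff_allI imp_cong refl) (simp add: assms)

lemma distortion_le_id: "1 \<le> M \<Longrightarrow> distortion_le M (\<lambda>x. x) u v"
  unfolding distortion_le_def
  by (auto simp: mult_ac intro!: mult_left_mono mult_right_mono)

lemma distortion_le_mono:
  assumes "strict_mono F" "distortion_le M F u v" "M \<le> M'" "u \<le> u'" "v' \<le> v"
  shows "distortion_le M' F u' v'"
  unfolding distortion_le_def
proof (intro allI impI)
  fix x y x' y' assume a: "u' \<le> x \<and> x < y \<and> y \<le> v' \<and> u' \<le> x' \<and> x' < y' \<and> y' \<le> v'"
  have "F x' < F y'" using a assms(1) by (simp add: strict_mono_less)
  have "(F y - F x) * (y' - x') \<le> M * (F y' - F x') * (y - x)"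
    using a assms by (intro distortion_leD[OF assms(2)]) auto
  also have "\<dots> \<le> M' * (F y' - F x') * (y - x)"
    using assms a \<open>F x' < F y'\<close> by (intro mult_right_mono) auto
  finally show "(F y - F x) * (y' - x') \<le> M' * (F y' - F x') * (y - x)" .
qed

lemma distortion_le_compose:
  assumes F: "strict_mono F" "distortion_le M F u v" and M: "0 \<le> M" and W: "strict_mono W"
    and ratio: "\<And>x y x' y'. F u \<le> x \<Longrightarrow> x < y \<Longrightarrow> y \<le> F v \<Longrightarrow> F u \<le> x' \<Longrightarrow> x' < y' \<Longrightarrow> y' \<le> F v \<Longrightarrow>
        (W y - W x) * (y' - x') \<le> K * (W y' - W x') * (y - x)"
  shows "distortion_le (K * M) (\<lambda>x. W (F x)) u v"
  unfolding distortion_le_def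
proof (intro allI impI)
  fix x y x' y' assume a: "u \<le> x \<and> x < y \<and> y \<le> v \<and> u \<le> x' \<and> x' < y' \<and> y' \<le> v"
  have lt: "F x < F y" "F x' < F y'" using a F(1) by (auto simp: strict_mono_less)
  have le: "F u \<le> F x" "F y \<le> F v" "F u \<le> F x'" "F y' \<le> F v"
    using a F(1) by (auto simp: strict_mono_less_eq)
  have r: "(W (F y) - W (F x)) * (F y' - F x') \<le> K * (W (F y') - W (F x')) * (F y - F x)"
    using lt le by (intro ratio) auto
  have Wx: "0 < W (F y) - W (F x)" using W lt by (simp add: strict_mono_less)
  \<comment> \<open>The sign of \<open>K * (W (F y') - W (F x'))\<close> is read off from the ratio
    inequality, whose left side is positive.\<close>
  have "0 < (W (F y) - W (F x)) * (F y' - F x')" using Wx lt by simp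
  then have "0 < (K * (W (F y') - W (F x'))) * (F y - F x)" using r by linarith
  then have KW: "0 < K * (W (F y') - W (F x'))" using lt by (simp add: zero_less_mult_iff)
  have "((W (F y) - W (F x)) * (F y' - F x')) * (y' - x') \<le> (K * (W (F y') - W (F x')) * (F y - F x)) * (y' - x')"
    using r a by (intro mult_right_mono) auto
  also have "\<dots> = (K * (W (F y') - W (F x'))) * ((F y - F x) * (y' - x'))" by (simp add: mult_ac)
  also have "\<dots> \<le> (K * (W (F y') - W (F x'))) * (M * (F y' - F x') * (y - x))"
    using KW a by (intro mult_left_mono distortion_leD[OF F(2)]) auto
  finally have "(F y' - F x') * ((W (F y) - W (F x)) * (y' - x'))
      \<le> (F y' - F x') * (K * M * (W (F y') - W (F x')) * (y - x))" by (simp add: mult_ac)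
  then show "(W (F y) - W (F x)) * (y' - x') \<le> K * M * (W (F y') - W (F x')) * (y - x)"
    using lt by simp
qed

text \<open>In \<open>distortion_F\<close> the full interval of radius \<open>200 * d v\<close> has
  exponent \<open>400 / 800\<close>; this turns its bound into the constant 2.\<close>

lemma exp_half_le_2: "exp (1 / 2 :: real) \<le> 2"
  using exp_bound_half[of "1 / 2 :: real"] by simp

subsection \<open>Sparse trees of intervals\<close>

text \<open>
  The hole of a node \<open>v \<in> T n\<close> contains the interval of radius \<open>\<kappa> n * (\<delta> * (hi v - lo v))\<close> about \<open>ctr v\<close>.
\<close>

locale sparse_cantor_tree =
  fixes T :: "nat \<Rightarrow> 'v set" and lo hi ctr :: "'v \<Rightarrow> real" and \<delta> p R :: real and \<kappa> :: "nat \<Rightarrow> real"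
  assumes p: "0 < p" "p < 1"
    and \<delta>: "0 < \<delta>" "\<delta> \<le> 1 / 12800"
    and R: "0 < R"
    and \<kappa>: "0 < \<kappa> n" "\<kappa> n < 1"
    and lo_less_hi: "v \<in> T n \<Longrightarrow> lo v < hi v"
    and separated: "v \<in> T n \<Longrightarrow> w \<in> T n \<Longrightarrow> v \<noteq> w \<Longrightarrow> hi v \<le> lo w \<or> hi w \<le> lo v"
    and central: "v \<in> T n \<Longrightarrow> lo v + 6400 * (\<delta> * (hi v - lo v)) \<le> ctr v"
      "v \<in> T n \<Longrightarrow> ctr v + 6400 * (\<delta> * (hi v - lo v)) \<le> hi v"
    and nested: "v \<in> T (Suc n) \<Longrightarrow> \<exists>w\<in>T n. lo w \<le> lo v \<and> hi v \<le> hi w \<and>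
        hi v - lo v \<le> \<delta> * (hi w - lo w) \<and>
        (hi v \<le> ctr w - \<kappa> n * (\<delta> * (hi w - lo w)) \<or> ctr w + \<kappa> n * (\<delta> * (hi w - lo w)) \<le> lo v)"
    and bounded_nodes: "v \<in> T n \<Longrightarrow> - R \<le> lo v" "v \<in> T n \<Longrightarrow> hi v \<le> R"
begin

section \<open>Warping radii and ancestors of nodes\<close>

definition d :: "'v \<Rightarrow> real" where "d v = \<delta> * (hi v - lo v)"

lemma d_pos: "v \<in> T n \<Longrightarrow> 0 < d v"
  using \<delta> lo_less_hi by (simp add: d_def)

lemma ctr_bounds: "v \<in> T n \<Longrightarrow> lo v + 6400 * d v \<le> ctr v" "v \<in> T n \<Longrightarrow> ctr v + 6400 * d v \<le> hi v"
  using central by (auto simp: d_def)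

lemma same_node: "v \<in> T n \<Longrightarrow> w \<in> T n \<Longrightarrow> lo v < x \<Longrightarrow> x < hi v \<Longrightarrow> lo w < x \<Longrightarrow> x < hi w \<Longrightarrow> v = w"
  using separated[of v n w] by force

text \<open>Iterates \<open>nested\<close>. The last clause persists because a descendant lies
  within a child of \<open>w\<close>, which is already on one side of the centre; so later nodes
  never have an earlier centre in their interior.\<close>

lemma ancestor:
  assumes "v \<in> T n" "k < n"
  shows "\<exists>w\<in>T k. lo w \<le> lo v \<and> hi v \<le> hi w \<and> hi v - lo v \<le> d w \<and> d v \<le> \<delta> * d w \<and>
        (hi v \<le> ctr w - \<kappa> k * d w \<or> ctr w + \<kappa> k * d w \<le> lo v)"
  using assms
proof (induction n arbitrary: v)
  case (Suc n)
  obtain w where w: "w \<in> T n" "lo w \<le> lo v" "hi v \<le> hi w" "hi v - lo v \<le> d w"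
        "hi v \<le> ctr w - \<kappa> n * d w \<or> ctr w + \<kappa> n * d w \<le> lo v"
    using nested[OF Suc.prems(1)] unfolding d_def by blast
  show ?case
  proof (cases "k = n")
    case True
    have "d v \<le> \<delta> * d w" using w \<delta> by (simp add: d_def[of v] mult_left_mono)
    then show ?thesis using w True by auto
  next
    case False
    then obtain x where x: "x \<in> T k" "lo x \<le> lo w" "hi w \<le> hi x" "hi w - lo w \<le> d x" "d w \<le> \<delta> * d x"
        "hi w \<le> ctr x - \<kappa> k * d x \<or> ctr x + \<kappa> k * d x \<le> lo w"
      using Suc.IH[OF w(1)] Suc.prems by auto
    have "hi v - lo v \<le> hi w - lo w" using w by simp
    then have "hi v - lo v \<le> d x" "d v \<le> d w" using x \<delta> by (auto simp: d_def[of v] d_def[of w])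
    then show ?thesis using w x by (intro bexI[of _ x]) auto
  qed
qed auto

lemma ancestor_of_point:
  assumes v: "v \<in> T n" and w: "w \<in> T k" and "k < n" "lo v < x" "x < hi v" "lo w < x" "x < hi w"
  shows "lo w \<le> lo v" "hi v \<le> hi w" "hi v - lo v \<le> d w" "d v \<le> \<delta> * d w"
    "hi v \<le> ctr w - \<kappa> k * d w \<or> ctr w + \<kappa> k * d w \<le> lo v"
proof -
  obtain w' where w': "w' \<in> T k" "lo w' \<le> lo v" "hi v \<le> hi w'" "hi v - lo v \<le> d w'" "d v \<le> \<delta> * d w'"
     "hi v \<le> ctr w' - \<kappa> k * d w' \<or> ctr w' + \<kappa> k * d w' \<le> lo v"
    using ancestor[OF v \<open>k < n\<close>] by blast
  have "w' = w" using same_node[OF w'(1) w, of x] assms w' by auto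
  then show "lo w \<le> lo v" "hi v \<le> hi w" "hi v - lo v \<le> d w" "d v \<le> \<delta> * d w"
    "hi v \<le> ctr w - \<kappa> k * d w \<or> ctr w + \<kappa> k * d w \<le> lo v" using w' by auto
qed

text \<open>Distribution function after the generations before \<open>n\<close>. The new warp acts
  on the values of \<open>F n\<close>, with the images of the centre and of the ends as its
  parameters, so \<open>F (Suc n)\<close> is locally \<open>F n\<close> followed by a warp. The
  chosen \<open>v\<close> is unique, as nodes of one generation have disjoint interiors.\<close>

primrec F :: "nat \<Rightarrow> real \<Rightarrow> real" where
  "F 0 = (\<lambda>x. x)"
| "F (Suc n) = (\<lambda>x. if \<exists>v\<in>T n. \<bar>x - ctr v\<bar> < d v
      then let v = (SOME v. v \<in> T n \<and> \<bar>x - ctr v\<bar> < d v)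
           in warp p (F n (ctr v - d v)) (F n (ctr v)) (F n (ctr v + d v)) (F n x)
      else F n x)"

lemma near_interior:
  assumes "v \<in> T n" "\<bar>x - ctr v\<bar> < 6400 * d v"
  shows "lo v < x" "x < hi v"
  using ctr_bounds[OF assms(1)] assms by auto

lemma F_Suc_outside:
  assumes "\<And>v. v \<in> T n \<Longrightarrow> d v \<le> \<bar>x - ctr v\<bar>"
  shows "F (Suc n) x = F n x"
proof -
  have "\<not> (\<exists>v\<in>T n. \<bar>x - ctr v\<bar> < d v)" using assms by (meson not_le)
  then show ?thesis by simp
qed

lemma F_Suc_near:
  assumes "v \<in> T n" "\<bar>x - ctr v\<bar> < d v"
  shows "F (Suc n) x = warp p (F n (ctr v - d v)) (F n (ctr v)) (F n (ctr v + d v)) (F n x)"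
proof -
  have "(SOME v. v \<in> T n \<and> \<bar>x - ctr v\<bar> < d v) = v"
  proof (rule some_equality)
    fix w assume "w \<in> T n \<and> \<bar>x - ctr w\<bar> < d w"
    then show "w = v"
      using near_interior[of w n x] near_interior[of v n x] d_pos[of v n] d_pos[of w n] assms
      by (intro same_node[of w n v x]) auto
  qed (use assms in auto)
  then show ?thesis using assms by (auto simp: Let_def)
qed

text \<open>Beyond radius \<open>d v\<close> the warp is the identity, and no other node of the
  generation reaches into the interior of \<open>v\<close>; so one formula covers the whole
  interior. Monotonicity of \<open>F n\<close> is discharged in
  \<open>F_Suc_interior\<close>.\<close>

lemma F_Suc_interior_aux:
  assumes m: "strict_mono (F n)" and v: "v \<in> T n" "lo v < x" "x < hi v"
  shows "F (Suc n) x = warp p (F n (ctr v - d v)) (F n (ctr v)) (F n (ctr v + d v)) (F n x)"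
proof (cases "\<bar>x - ctr v\<bar> < d v")
  case True
  then show ?thesis using F_Suc_near v by simp
next
  case False
  have d: "0 < d v" using d_pos v by simp
  have "F (Suc n) x = F n x"
  proof (rule F_Suc_outside)
    fix w assume w: "w \<in> T n"
    show "d w \<le> \<bar>x - ctr w\<bar>"
    proof (rule ccontr)
      assume c: "\<not> d w \<le> \<bar>x - ctr w\<bar>"
      then have "w = v" using near_interior[OF w, of x] same_node[OF w v(1), of x] v by auto
      then show False using False c by simp
    qed
  qed
  moreover have "warp p (F n (ctr v - d v)) (F n (ctr v)) (F n (ctr v + d v)) (F n x) = F n x"
    using m d False by (intro warp_outside) (auto simp: strict_mono_less strict_mono_less_eq)
  ultimately show ?thesis by simp
qed

text \<open>Warps fix the ends of their intervals. So \<open>F (Suc n) x\<close> is compared with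
  \<open>F n\<close> at \<open>x\<close> itself or, if \<open>x\<close> is warped, at an end of its
  warped interval (\<open>up\<close>, \<open>down\<close>). This settles all pairs except two points
  of one warped interval, where the warp itself is increasing.\<close>

lemma strict_mono_F: "strict_mono (F n)"
proof (induction n)
  case 0
  show ?case by (simp add: strict_mono_def)
next
  case (Suc n)
  let ?W = "\<lambda>v. warp p (F n (ctr v - d v)) (F n (ctr v)) (F n (ctr v + d v))"
  have up: "\<exists>t\<ge>x. F (Suc n) x \<le> F n t \<and> (x < t \<longrightarrow> F (Suc n) x < F n t) \<and>
       ((t = x \<and> (\<forall>v\<in>T n. d v \<le> \<bar>x - ctr v\<bar>)) \<or> (\<exists>v\<in>T n. \<bar>x - ctr v\<bar> < d v \<and> t = ctr v + d v))" for x
  proof (cases "\<exists>v\<in>T n. \<bar>x - ctr v\<bar> < d v")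
    case True
    then obtain v where v: "v \<in> T n" "\<bar>x - ctr v\<bar> < d v" by auto
    have "0 < d v" using d_pos v by simp
    then have "?W v (F n x) < ?W v (F n (ctr v + d v))"
      using Suc v p by (intro warp_strict_mono) (auto simp: strict_mono_less)
    also have "?W v (F n (ctr v + d v)) = F n (ctr v + d v)"
      using \<open>0 < d v\<close> Suc by (intro warp_outside) (auto simp: strict_mono_less)
    finally show ?thesis using F_Suc_near[OF v] v by (intro exI[of _ "ctr v + d v"]) auto
  next
    case False
    then have "\<forall>v\<in>T n. d v \<le> \<bar>x - ctr v\<bar>" by auto
    then show ?thesis using F_Suc_outside[of n x] by (intro exI[of _ x]) (auto simp del: F.simps)
  qed
  have down: "\<exists>t\<le>x. F n t \<le> F (Suc n) x \<and> (t < x \<longrightarrow> F n t < F (Suc n) x) \<and>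
       ((t = x \<and> (\<forall>v\<in>T n. d v \<le> \<bar>x - ctr v\<bar>)) \<or> (\<exists>v\<in>T n. \<bar>x - ctr v\<bar> < d v \<and> t = ctr v - d v))" for x
  proof (cases "\<exists>v\<in>T n. \<bar>x - ctr v\<bar> < d v")
    case True
    then obtain v where v: "v \<in> T n" "\<bar>x - ctr v\<bar> < d v" by auto
    have "0 < d v" using d_pos v by simp
    then have "?W v (F n (ctr v - d v)) < ?W v (F n x)"
      using Suc v p by (intro warp_strict_mono) (auto simp: strict_mono_less)
    moreover have "?W v (F n (ctr v - d v)) = F n (ctr v - d v)"
      using \<open>0 < d v\<close> Suc by (intro warp_outside) (auto simp: strict_mono_less)
    ultimately show ?thesis using F_Suc_near[OF v] v by (intro exI[of _ "ctr v - d v"]) auto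
  next
    case False
    then have "\<forall>v\<in>T n. d v \<le> \<bar>x - ctr v\<bar>" by auto
    then show ?thesis using F_Suc_outside[of n x] by (intro exI[of _ x]) (auto simp del: F.simps)
  qed
  show ?case
  proof (rule strict_monoI)
    fix x y :: real assume "x < y"
    obtain t where t: "x \<le> t" "F (Suc n) x \<le> F n t" "x < t \<longrightarrow> F (Suc n) x < F n t"
       "(t = x \<and> (\<forall>v\<in>T n. d v \<le> \<bar>x - ctr v\<bar>)) \<or> (\<exists>v\<in>T n. \<bar>x - ctr v\<bar> < d v \<and> t = ctr v + d v)"
      using up[of x] by blast
    obtain s where s: "s \<le> y" "F n s \<le> F (Suc n) y" "s < y \<longrightarrow> F n s < F (Suc n) y"
       "(s = y \<and> (\<forall>v\<in>T n. d v \<le> \<bar>y - ctr v\<bar>)) \<or> (\<exists>v\<in>T n. \<bar>y - ctr v\<bar> < d v \<and> s = ctr v - d v)"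
      using down[of y] by blast
    show "F (Suc n) x < F (Suc n) y"
    proof (cases "t \<le> s")
      case True
      then have le: "F n t \<le> F n s" using Suc by (simp add: strict_mono_less_eq)
      consider "x < t" | "s < y" | "t < s" using \<open>x < y\<close> t s by linarith
      then show ?thesis
      proof cases
        case 1 then show ?thesis using le t(2,3) s(2,3) by linarith
      next
        case 2 then show ?thesis using le t(2,3) s(2,3) by linarith
      next
        case 3
        then have "F n t < F n s" using Suc by (simp add: strict_mono_less)
        then show ?thesis using t(2) s(2) by linarith
      qed
    next
      case False
      \<comment> \<open>If the comparison points are in the wrong order, \<open>x\<close> and
        \<open>y\<close> share a warped interval.\<close>
      have "\<exists>v\<in>T n. \<bar>x - ctr v\<bar> < d v \<and> \<bar>y - ctr v\<bar> < d v"
        using t(4)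
      proof
        assume tx: "t = x \<and> (\<forall>v\<in>T n. d v \<le> \<bar>x - ctr v\<bar>)"
        then obtain w where w: "w \<in> T n" "\<bar>y - ctr w\<bar> < d w" "s = ctr w - d w"
          using s(4) False \<open>x < y\<close> by auto
        then have "d w \<le> \<bar>x - ctr w\<bar>" using tx by blast
        then show ?thesis using w False tx \<open>x < y\<close> by (auto simp: abs_if split: if_splits)
      next
        assume "\<exists>v\<in>T n. \<bar>x - ctr v\<bar> < d v \<and> t = ctr v + d v"
        then obtain v where v: "v \<in> T n" "\<bar>x - ctr v\<bar> < d v" "t = ctr v + d v" by blast
        show ?thesis using s(4)
        proof
          assume "s = y \<and> (\<forall>v\<in>T n. d v \<le> \<bar>y - ctr v\<bar>)"
          then have "s = y" "d v \<le> \<bar>y - ctr v\<bar>" using v by blast+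
          then show ?thesis using v False \<open>x < y\<close> by (auto simp: abs_if split: if_splits)
        next
          assume "\<exists>v\<in>T n. \<bar>y - ctr v\<bar> < d v \<and> s = ctr v - d v"
          then obtain w where w: "w \<in> T n" "\<bar>y - ctr w\<bar> < d w" "s = ctr w - d w" by blast
          have "v = w"
          proof (rule ccontr)
            assume "v \<noteq> w"
            then show False
              using separated[OF v(1) w(1)] ctr_bounds[OF v(1)] ctr_bounds[OF w(1)] v w False \<open>x < y\<close>
                d_pos[OF v(1)] d_pos[OF w(1)] by (auto simp: abs_if split: if_splits)
          qed
          then show ?thesis using v w by auto
        qed
      qed
      then obtain v where v: "v \<in> T n" "\<bar>x - ctr v\<bar> < d v" "\<bar>y - ctr v\<bar> < d v" by auto
      have "0 < d v" using d_pos v by simp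
      then have "?W v (F n x) < ?W v (F n y)"
        using Suc v p \<open>x < y\<close> by (intro warp_strict_mono) (auto simp: strict_mono_less)
      then show ?thesis using F_Suc_near[OF v(1,2)] F_Suc_near[OF v(1,3)] by simp
    qed
  qed
qed

section \<open>Points left fixed by later generations, and distortion of the maps\<close>

declare F.simps(2) [simp del]

lemma F_less_iff [simp]: "F n x < F n y \<longleftrightarrow> x < y"
  using strict_mono_F by (rule strict_mono_less)

lemma F_le_iff [simp]: "F n x \<le> F n y \<longleftrightarrow> x \<le> y"
  using strict_mono_F by (rule strict_mono_less_eq)

lemma F_Suc_interior:
  assumes "v \<in> T n" "lo v < x" "x < hi v"
  shows "F (Suc n) x = warp p (F n (ctr v - d v)) (F n (ctr v)) (F n (ctr v + d v)) (F n x)"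
  using F_Suc_interior_aux[OF strict_mono_F assms] .

lemma strict_mono_warp_F:
  "v \<in> T n \<Longrightarrow> strict_mono (warp p (F n (ctr v - d v)) (F n (ctr v)) (F n (ctr v + d v)))"
  using p d_pos by (intro strict_monoI warp_strict_mono) auto

lemma F_unchanged:
  assumes "n \<le> N" "\<And>j v. n \<le> j \<Longrightarrow> j < N \<Longrightarrow> v \<in> T j \<Longrightarrow> d v \<le> \<bar>x - ctr v\<bar>"
  shows "F N x = F n x"
  using assms
proof (induction N rule: dec_induct)
  case (step N)
  then show ?case using F_Suc_outside[of N x] by simp
qed simp

text \<open>Warps from generation \<open>n\<close> on act in the interiors of nodes, all contained
  in nodes of generation \<open>n\<close>.\<close>

lemma F_stable:
  assumes "n \<le> N" "\<And>v. v \<in> T n \<Longrightarrow> \<not> (lo v < x \<and> x < hi v)"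
  shows "F N x = F n x"
proof (rule F_unchanged[OF assms(1)], rule ccontr)
  fix j v assume j: "n \<le> j" "j < N" "v \<in> T j" "\<not> d v \<le> \<bar>x - ctr v\<bar>"
  then have x: "lo v < x" "x < hi v" using near_interior[of v j x] by auto
  show False
  proof (cases "j = n")
    case True
    then show False using assms(2) x j by auto
  next
    case False
    then obtain w where "w \<in> T n" "lo w \<le> lo v" "hi v \<le> hi w" using ancestor[of v j n] j by auto
    then show False using assms(2)[of w] x by auto
  qed
qed

lemma endpoint_not_interior:
  assumes "v \<in> T n" "w \<in> T n" "x = lo v \<or> x = hi v"
  shows "\<not> (lo w < x \<and> x < hi w)"
  using separated[OF assms(1,2)] lo_less_hi[OF assms(1)] lo_less_hi[OF assms(2)] assms(3)
  by (cases "v = w") auto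

lemma F_endpoint: "v \<in> T n \<Longrightarrow> n \<le> N \<Longrightarrow> x = lo v \<or> x = hi v \<Longrightarrow> F N x = F n x"
  using endpoint_not_interior by (intro F_stable) auto

text \<open>
  Only the last ancestor warping a point of the given interval contributes a factor which is not already controlled
  on a much larger scale, hence the distortion is controlled by the ratio of the length to \<open>d v\<close>.
\<close>

lemma distortion_F:
  assumes "v \<in> T n" "ctr v - 200 * d v \<le> e1" "e1 \<le> e2" "e2 \<le> ctr v + 200 * d v"
  shows "distortion_le (exp ((e2 - e1) / (800 * d v))) (F n) e1 e2"
  using assms
proof (induction n arbitrary: v e1 e2 rule: less_induct)
  case (less n)
  note v = less.prems(1)
  have dv: "0 < d v" using d_pos v by simp
  \<comment> \<open>Generations with a warp reaching into \<open>[e1, e2]\<close>; without any,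
    \<open>F n\<close> is the identity there.\<close>
  define act where "act k \<longleftrightarrow> k < n \<and> (\<exists>w\<in>T k. \<exists>x. e1 \<le> x \<and> x \<le> e2 \<and> \<bar>x - ctr w\<bar> < d w)" for k
  show ?case
  proof (cases "\<exists>k. act k")
    case False
    have "F n x = x" if "e1 \<le> x" "x \<le> e2" for x
      using F_unchanged[of 0 n x] False that unfolding act_def by (metis F.simps(1) le0 not_le)
    then have "distortion_le (exp ((e2 - e1) / (800 * d v))) (F n) e1 e2
        \<longleftrightarrow> distortion_le (exp ((e2 - e1) / (800 * d v))) (\<lambda>x. x) e1 e2"
      by (intro distortion_le_cong) auto
    then show ?thesis using distortion_le_id less.prems dv by simp
  next
    case True
    define k where "k = Max {k. act k}"
    have fin: "finite {k. act k}" by (rule finite_subset[of _ "{..<n}"]) (auto simp: act_def)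
    have "act k" using Max_in[OF fin] True by (auto simp: k_def)
    have max: "j \<le> k" if "act j" for j using Max_ge[OF fin] that by (auto simp: k_def)
    from \<open>act k\<close> obtain w x where w: "k < n" "w \<in> T k" "e1 \<le> x" "x \<le> e2" "\<bar>x - ctr w\<bar> < d w"
      by (auto simp: act_def)
    have dw: "0 < d w" using d_pos w by simp
    have xv: "lo v < x" "x < hi v" using ctr_bounds[OF v] less.prems w dv by auto
    have xw: "lo w < x" "x < hi w" using ctr_bounds[OF w(2)] w by (auto simp: abs_less_iff abs_le_iff)
    note anc = ancestor_of_point[OF v w(2,1) xv xw]
    have "\<delta> * d w \<le> d w / 12800" using \<delta> dw by (simp add: mult.commute)
    then have dvw: "12800 * d v \<le> d w" using anc(4) by simp
    \<comment> \<open>Since \<open>400 * d v \<le> d w\<close> and some point is within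
      \<open>d w\<close> of \<open>ctr w\<close>, the interval lies in the range of the induction
      hypothesis for \<open>w\<close>.\<close>
    have E: "e2 - e1 \<le> d w" using dvw less.prems dv by simp
    have FnS: "F n y = F (Suc k) y" if "e1 \<le> y" "y \<le> e2" for y
    proof (rule F_unchanged)
      show "Suc k \<le> n" using w by simp
      fix j u assume j: "Suc k \<le> j" "j < n" "u \<in> T j"
      show "d u \<le> \<bar>y - ctr u\<bar>"
      proof (rule ccontr)
        assume "\<not> d u \<le> \<bar>y - ctr u\<bar>"
        then have "act j" using j that unfolding act_def by (auto intro!: bexI[of _ u] exI[of _ y])
        then show False using max j by fastforce
      qed
    qed
    let ?W = "warp p (F k (ctr w - d w)) (F k (ctr w)) (F k (ctr w + d w))"
    have Sk: "F (Suc k) y = ?W (F k y)" if "e1 \<le> y" "y \<le> e2" for y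
      using that less.prems ctr_bounds[OF v] anc dv by (intro F_Suc_interior[OF w(2)]) auto
    have IH: "distortion_le (exp ((e2 - e1) / (800 * d w))) (F k) e1 e2"
      using w E dw less.prems by (intro less.IH[OF w(1,2)]) (auto simp: abs_less_iff abs_le_iff)
    have half: "(ctr w + 200 * d w - (ctr w - 200 * d w)) / (800 * d w) = 1 / 2"
      using dw by (simp add: field_simps)
    have "distortion_le (exp ((ctr w + 200 * d w - (ctr w - 200 * d w)) / (800 * d w))) (F k)
        (ctr w - 200 * d w) (ctr w + 200 * d w)"
      using dw by (intro less.IH[OF w(1,2)]) auto
    then have IHW: "distortion_le 2 (F k) (ctr w - 200 * d w) (ctr w + 200 * d w)"
      unfolding half by (rule distortion_le_mono[OF strict_mono_F _ exp_half_le_2 order_refl order_refl])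
    \<comment> \<open>\<open>ctr w\<close> is not interior to \<open>v\<close>, and the interval
      stays \<open>6400 * d v - 200 * d v\<close> away from the ends of \<open>v\<close>.\<close>
    have side: "ctr w + 6200 * d v \<le> e1 \<or> e2 \<le> ctr w - 6200 * d v"
      using anc(5) ctr_bounds[OF v] less.prems mult_pos_pos[OF \<kappa>(1)[of k] dw] by auto
    \<comment> \<open>Length over distance from the centre, at most
      \<open>(e2 - e1) / (6200 * d v)\<close>, doubled by the distortion 2 of \<open>F k\<close>:
      this bounds the same ratio for the images, so the last warp contributes at most
      \<open>1 + t\<close>.\<close>
    define t where "t = (e2 - e1) / (3100 * d v)"
    have dist: "distortion_le ((1 + t) * exp ((e2 - e1) / (800 * d w))) (\<lambda>x. ?W (F k x)) e1 e2"
    proof (cases "e1 = e2")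
      case True
      then show ?thesis by (auto simp: distortion_le_def)
    next
      case False
      then have lt: "e1 < e2" using less.prems by simp
      show ?thesis
      proof (rule distortion_le_compose[OF strict_mono_F IH _ strict_mono_warp_F[OF w(2)]])
        fix x y x' y'
        assume xy: "F k e1 \<le> x" "x < y" "y \<le> F k e2" "F k e1 \<le> x'" "x' < y'" "y' \<le> F k e2"
        have pos: "0 < ?W y' - ?W x'" using strict_mono_warp_F[OF w(2)] xy by (simp add: strict_mono_less)
        show "(?W y - ?W x) * (y' - x') \<le> (1 + t) * (?W y' - ?W x') * (y - x)"
          using side
        proof
          assume s: "ctr w + 6200 * d v \<le> e1"
          then have "ctr w < e1" using dv by linarith
          define m where "m = F k e1 - F k (ctr w)"
          have "0 < m" using \<open>ctr w < e1\<close> by (simp add: m_def)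
          have "(F k e2 - F k e1) * (e1 - ctr w) \<le> 2 * (F k e1 - F k (ctr w)) * (e2 - e1)"
            by (rule distortion_leD[OF IHW])
              (use \<open>ctr w < e1\<close> lt w E dw in \<open>auto simp: abs_less_iff abs_le_iff\<close>)
          moreover have "(F k e2 - F k e1) * (6200 * d v) \<le> (F k e2 - F k e1) * (e1 - ctr w)"
            using s lt by (intro mult_left_mono) auto
          ultimately have "F k e2 - F k e1 \<le> t * m"
            using dv by (simp add: t_def m_def field_simps)
          then have n: "F k e2 - F k (ctr w) \<le> (1 + t) * m" by (simp add: m_def algebra_simps)
          have "(?W y - ?W x) * (y' - x') * m \<le> (F k e2 - F k (ctr w)) * (?W y' - ?W x') * (y - x)"
            unfolding m_def using p dw xy \<open>ctr w < e1\<close> by (intro warp_quotient_ratio) auto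
          also have "\<dots> \<le> ((1 + t) * m) * (?W y' - ?W x') * (y - x)"
            using n pos xy by (intro mult_right_mono) auto
          finally have "m * ((?W y - ?W x) * (y' - x')) \<le> m * ((1 + t) * (?W y' - ?W x') * (y - x))"
            by (simp add: mult_ac)
          then show ?thesis using \<open>0 < m\<close> by simp
        next
          assume s: "e2 \<le> ctr w - 6200 * d v"
          then have "e2 < ctr w" using dv by linarith
          define m where "m = F k (ctr w) - F k e2"
          have "0 < m" using \<open>e2 < ctr w\<close> by (simp add: m_def)
          have "(F k e2 - F k e1) * (ctr w - e2) \<le> 2 * (F k (ctr w) - F k e2) * (e2 - e1)"
            by (rule distortion_leD[OF IHW])
              (use \<open>e2 < ctr w\<close> lt w E dw in \<open>auto simp: abs_less_iff abs_le_iff\<close>)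
          moreover have "(F k e2 - F k e1) * (6200 * d v) \<le> (F k e2 - F k e1) * (ctr w - e2)"
            using s lt by (intro mult_left_mono) auto
          ultimately have "F k e2 - F k e1 \<le> t * m"
            using dv by (simp add: t_def m_def field_simps)
          then have n: "F k (ctr w) - F k e1 \<le> (1 + t) * m" by (simp add: m_def algebra_simps)
          have "(?W y - ?W x) * (y' - x') * m \<le> (F k (ctr w) - F k e1) * (?W y' - ?W x') * (y - x)"
            unfolding m_def using p dw xy \<open>e2 < ctr w\<close> by (intro warp_quotient_ratio_left) auto
          also have "\<dots> \<le> ((1 + t) * m) * (?W y' - ?W x') * (y - x)"
            using n pos xy by (intro mult_right_mono) auto
          finally have "m * ((?W y - ?W x) * (y' - x')) \<le> m * ((1 + t) * (?W y' - ?W x') * (y - x))"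
            by (simp add: mult_ac)
          then show ?thesis using \<open>0 < m\<close> by simp
        qed
      qed simp
    qed
    have "(1 + t) * exp ((e2 - e1) / (800 * d w)) \<le> exp t * exp ((e2 - e1) / (800 * d w))"
      by (intro mult_right_mono exp_ge_add_one_self) auto
    also have "\<dots> = exp (t + (e2 - e1) / (800 * d w))" by (simp add: exp_add)
    also have "\<dots> \<le> exp ((e2 - e1) / (800 * d v))"
    proof -
      \<comment> \<open>The older warps enter at the scale \<open>d w \<ge> 12800 * d v\<close>
        only, and \<open>1 / 3100 + 1 / (800 * 12800) \<le> 1 / 800\<close>.\<close>
      have "(e2 - e1) / (800 * d w) \<le> (e2 - e1) / (800 * (12800 * d v))"
        using dvw less.prems dv by (intro divide_left_mono) auto
      moreover have "t + (e2 - e1) / (800 * (12800 * d v)) \<le> (e2 - e1) / (800 * d v)"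
        using less.prems dv by (simp add: t_def field_simps)
      ultimately show ?thesis by simp
    qed
    finally have c: "(1 + t) * exp ((e2 - e1) / (800 * d w)) \<le> exp ((e2 - e1) / (800 * d v))" .
    have "distortion_le ((1 + t) * exp ((e2 - e1) / (800 * d w))) (F n) e1 e2
        \<longleftrightarrow> distortion_le ((1 + t) * exp ((e2 - e1) / (800 * d w))) (\<lambda>x. ?W (F k x)) e1 e2"
      by (intro distortion_le_cong) (simp add: FnS Sk)
    then show ?thesis using dist distortion_le_mono[OF strict_mono_F _ c order_refl order_refl] by blast
  qed
qed

lemma distortion_F_2:
  assumes v: "v \<in> T n"
  shows "distortion_le 2 (F n) (ctr v - 200 * d v) (ctr v + 200 * d v)"
proof -
  have "0 < d v" using d_pos v by simp
  then have half: "(ctr v + 200 * d v - (ctr v - 200 * d v)) / (800 * d v) = 1 / 2"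
    by (simp add: field_simps)
  have "distortion_le (exp ((ctr v + 200 * d v - (ctr v - 200 * d v)) / (800 * d v))) (F n)
      (ctr v - 200 * d v) (ctr v + 200 * d v)"
    using v \<open>0 < d v\<close> by (intro distortion_F) auto
  then show ?thesis
    unfolding half by (rule distortion_le_mono[OF strict_mono_F _ exp_half_le_2 order_refl order_refl])
qed

text \<open>
  If only warpings of radius below \<open>s / 25\<close> remain, they move mass by at most \<open>s / 4\<close>: the first one coming close to
  \<open>y\<close> is trapped between two points \<open>a\<close>, \<open>b\<close> at which none of the functions changes.
\<close>

lemma F_displacement:
  assumes nN: "n \<le> N" and s: "0 < s" and y: "x - s \<le> y" "y \<le> x + s"
    and small: "\<And>j v t. n \<le> j \<Longrightarrow> j < N \<Longrightarrow> v \<in> T j \<Longrightarrow> x - 2 * s \<le> t \<Longrightarrow> t \<le> x + 2 * s \<Longrightarrow> \<bar>t - ctr v\<bar> < d v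
        \<Longrightarrow> 25 * d v < s"
  shows "F n (y - s / 4) \<le> F N y" "F N y \<le> F n (y + s / 4)"
proof -
  \<comment> \<open>With \<open>2 * d v\<close>, twice the warping radius, an earlier warp reaching
    a trapping point near \<open>y\<close> is a hit too, against the minimality of
    \<open>k\<close>.\<close>
  define hit where "hit k \<longleftrightarrow> n \<le> k \<and> k < N \<and> (\<exists>v\<in>T k. 25 * d v < s \<and> \<bar>y - ctr v\<bar> \<le> 2 * d v)" for k
  have "F n (y - s / 4) \<le> F N y \<and> F N y \<le> F n (y + s / 4)"
  proof (cases "\<exists>k. hit k")
    case False
    have "F N y = F n y"
    proof (rule F_unchanged[OF nN], rule ccontr)
      fix j v assume j: "n \<le> j" "j < N" "v \<in> T j" "\<not> d v \<le> \<bar>y - ctr v\<bar>"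
      then have "25 * d v < s" using small[of j v y] y s by auto
      then have "hit j" using j d_pos[of v j] by (auto simp: hit_def)
      then show False using False by blast
    qed
    then show ?thesis using s by simp
  next
    case True
    define k where "k = (LEAST k. hit k)"
    have "hit k" using True unfolding k_def by (metis LeastI)
    have least: "\<not> hit j" if "j < k" for j using that not_less_Least unfolding k_def by blast
    obtain v where v: "n \<le> k" "k < N" "v \<in> T k" "25 * d v < s" "\<bar>y - ctr v\<bar> \<le> 2 * d v"
      using \<open>hit k\<close> by (auto simp: hit_def)
    have dv: "0 < d v" using d_pos v by simp
    \<comment> \<open>Such a point is beyond the warp of \<open>v\<close>; later warps are excluded
      by \<open>F_stable\<close>, earlier ones by minimality of \<open>k\<close>.\<close>
    have fixed: "F N b = F n b"
      if b: "2 * d v \<le> \<bar>b - ctr v\<bar>" "\<bar>b - ctr v\<bar> \<le> 3 * d v"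
        "\<And>w. w \<in> T (Suc k) \<Longrightarrow> \<not> (lo w < b \<and> b < hi w)" for b
    proof -
      have bv: "lo v < b" "b < hi v" using near_interior[OF v(3), of b] b dv by auto
      have by': "\<bar>b - y\<bar> \<le> 5 * d v" using b v by (auto simp: abs_less_iff abs_le_iff)
      have "F N b = F (Suc k) b" using v b(3) by (intro F_stable) auto
      also have "\<dots> = F n b"
      proof (rule F_unchanged, use v in simp, rule ccontr)
        fix j w assume j: "n \<le> j" "j < Suc k" "w \<in> T j" "\<not> d w \<le> \<bar>b - ctr w\<bar>"
        have bw: "lo w < b" "b < hi w" using near_interior[OF j(3), of b] j by auto
        show False
        proof (cases "j = k")
          case True
          then have "w = v" using same_node[of w k v b] j v bw bv by auto
          then show False using b j dv by simp
        next
          case False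
          then have "j < k" using j by simp
          have "d v \<le> \<delta> * d w" using ancestor_of_point(4)[OF v(3) j(3) \<open>j < k\<close> bv bw] .
          moreover have "\<delta> * d w \<le> d w / 12800" using \<delta> d_pos[OF j(3)] by (simp add: mult.commute)
          ultimately have dvw: "12800 * d v \<le> d w" by simp
          have "25 * d w < s" using small[of j w b] j v by' y dv nN by auto
          moreover have "\<bar>y - ctr w\<bar> \<le> 2 * d w"
            using j by' dvw dv by (auto simp: abs_less_iff abs_le_iff)
          ultimately have "hit j" using j v by (auto simp: hit_def)
          then show False using least \<open>j < k\<close> by blast
        qed
      qed
      finally show ?thesis .
    qed
    have child: "hi w - lo w \<le> d v" if "w \<in> T (Suc k)" "lo w < t" "t < hi w" "\<bar>t - ctr v\<bar> \<le> 2 * d v" for w t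
      using ancestor_of_point(3)[of w "Suc k" v k t] that v near_interior[OF v(3), of t] dv by auto
    \<comment> \<open>If a node of the next generation covers the point at distance
      \<open>2 * d v\<close>, its endpoint is taken instead; its length is at most
      \<open>d v\<close>.\<close>
    obtain b where b: "ctr v + 2 * d v \<le> b" "b \<le> ctr v + 3 * d v"
        "\<And>w. w \<in> T (Suc k) \<Longrightarrow> \<not> (lo w < b \<and> b < hi w)"
    proof (cases "\<exists>w\<in>T (Suc k). lo w < ctr v + 2 * d v \<and> ctr v + 2 * d v < hi w")
      case False
      then show ?thesis using that[of "ctr v + 2 * d v"] dv by auto
    next
      case True
      then obtain w where w: "w \<in> T (Suc k)" "lo w < ctr v + 2 * d v" "ctr v + 2 * d v < hi w" by auto
      then have "hi w - lo w \<le> d v" using child[of w] dv by auto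
      then show ?thesis using that[of "hi w"] endpoint_not_interior[OF w(1)] w by auto
    qed
    obtain a where a: "ctr v - 3 * d v \<le> a" "a \<le> ctr v - 2 * d v"
        "\<And>w. w \<in> T (Suc k) \<Longrightarrow> \<not> (lo w < a \<and> a < hi w)"
    proof (cases "\<exists>w\<in>T (Suc k). lo w < ctr v - 2 * d v \<and> ctr v - 2 * d v < hi w")
      case False
      then show ?thesis using that[of "ctr v - 2 * d v"] dv by auto
    next
      case True
      then obtain w where w: "w \<in> T (Suc k)" "lo w < ctr v - 2 * d v" "ctr v - 2 * d v < hi w" by auto
      then have "hi w - lo w \<le> d v" using child[of w] dv by auto
      then show ?thesis using that[of "lo w"] endpoint_not_interior[OF w(1)] w by auto
    qed
    have "F N b = F n b" by (rule fixed) (use a b dv in auto)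
    moreover have "F N a = F n a" by (rule fixed) (use a b dv in auto)
    moreover have "F N a \<le> F N y" "F N y \<le> F N b" using a b v by (auto simp: abs_less_iff abs_le_iff)
    \<comment> \<open>The trapping points are within \<open>5 * d v < s / 5\<close> of
      \<open>y\<close>; hence the constant 25.\<close>
    moreover have "F n b \<le> F n (y + s / 4)" "F n (y - s / 4) \<le> F n a"
      using a b v by (auto simp: abs_less_iff abs_le_iff)
    ultimately show ?thesis by linarith
  qed
  then show "F n (y - s / 4) \<le> F N y" "F N y \<le> F n (y + s / 4)" by auto
qed

text \<open>At scale \<open>s\<close> one generation is decisive: the last with a warp of radius at
  least \<open>s / 25\<close> near \<open>x\<close>. Later ones amount to shifting endpoints by
  \<open>s / 4\<close>, the map before it has distortion 2 there, and the warp itself obeys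
  \<open>warp_quasisymmetric\<close>. The choices \<open>y = x - s / 2\<close> and
  \<open>y = x + s / 2\<close> yield quasisymmetry.\<close>

lemma F_doubling:
  assumes s: "0 < s" and y: "x - s / 2 \<le> y" "y \<le> x + s / 2"
  shows "F N (x + s) - F N (x - s) \<le> 60 / p\<^sup>2 * (F N (y + s / 2) - F N (y - s / 2))"
proof -
  define act where "act k \<longleftrightarrow> k < N \<and> (\<exists>v\<in>T k. s \<le> 25 * d v \<and> (\<exists>t. x - 2 * s \<le> t \<and> t \<le> x + 2 * s \<and> \<bar>t - ctr v\<bar> < d v))" for k
  have p2: "0 < p\<^sup>2" "p\<^sup>2 \<le> 1" using p by (auto simp: power_le_one)
  have disp: "F N (x + s) - F N (x - s) \<le> F n (x + 5 / 4 * s) - F n (x - 5 / 4 * s)"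
      "F n (y + s / 4) - F n (y - s / 4) \<le> F N (y + s / 2) - F N (y - s / 2)"
    if n: "n \<le> N" "\<And>j. n \<le> j \<Longrightarrow> \<not> act j" for n
  proof -
    have small: "25 * d v < s" if "n \<le> j" "j < N" "v \<in> T j" "x - 2 * s \<le> t" "t \<le> x + 2 * s" "\<bar>t - ctr v\<bar> < d v" for j v t
      using n(2)[OF that(1)] that unfolding act_def by (meson not_le)
    note D = F_displacement[OF n(1) s _ _ small]
    have "F N (x + s) \<le> F n ((x + s) + s / 4)" by (rule D(2)) (use s in auto)
    moreover have "F n ((x - s) - s / 4) \<le> F N (x - s)" by (rule D(1)) (use s in auto)
    moreover have "F n ((y + s / 2) - s / 4) \<le> F N (y + s / 2)" by (rule D(1)) (use s y in auto)
    moreover have "F N (y - s / 2) \<le> F n ((y - s / 2) + s / 4)" by (rule D(2)) (use s y in auto)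
    moreover have "(x + s) + s / 4 = x + 5 / 4 * s" "(x - s) - s / 4 = x - 5 / 4 * s"
      "(y + s / 2) - s / 4 = y + s / 4" "(y - s / 2) + s / 4 = y - s / 4" by auto
    ultimately show "F N (x + s) - F N (x - s) \<le> F n (x + 5 / 4 * s) - F n (x - 5 / 4 * s)"
      "F n (y + s / 4) - F n (y - s / 4) \<le> F N (y + s / 2) - F N (y - s / 2)" by auto
  qed
  have main: "\<exists>n\<le>N. (\<forall>j\<ge>n. \<not> act j) \<and>
     F n (x + 5 / 4 * s) - F n (x - 5 / 4 * s) \<le> 60 / p\<^sup>2 * (F n (y + s / 4) - F n (y - s / 4))"
  proof (cases "\<exists>k. act k")
    case False
    have "5 * s / 2 \<le> 60 * (s / 2)" using s by simp
    also have "\<dots> \<le> 60 / p\<^sup>2 * (s / 2)" using s p2 by (intro mult_right_mono) (auto simp: field_simps)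
    finally show ?thesis using False by (intro exI[of _ 0]) auto
  next
    case True
    define k where "k = Max {k. act k}"
    have fin: "finite {k. act k}" by (rule finite_subset[of _ "{..<N}"]) (auto simp: act_def)
    have "act k" using Max_in[OF fin] True by (auto simp: k_def)
    have max: "j \<le> k" if "act j" for j using Max_ge[OF fin] that by (auto simp: k_def)
    from \<open>act k\<close> obtain v t where v: "k < N" "v \<in> T k" "s \<le> 25 * d v"
      "x - 2 * s \<le> t" "t \<le> x + 2 * s" "\<bar>t - ctr v\<bar> < d v" by (auto simp: act_def)
    have dv: "0 < d v" using d_pos v by simp
    \<comment> \<open>\<open>4 * s + d v \<le> 101 * d v\<close>, well within the range of
      \<open>distortion_F_2\<close>.\<close>
    have xc: "ctr v - 101 * d v < z \<and> z < ctr v + 101 * d v" if "x - 2 * s \<le> z" "z \<le> x + 2 * s" for z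
      using that v by (auto simp: abs_less_iff abs_le_iff)
    let ?W = "warp p (F k (ctr v - d v)) (F k (ctr v)) (F k (ctr v + d v))"
    have Sk: "F (Suc k) z = ?W (F k z)" if "x - 2 * s \<le> z" "z \<le> x + 2 * s" for z
      using xc[OF that] near_interior[OF v(2), of z] dv by (intro F_Suc_interior[OF v(2)]) auto
    note dist = distortion_leD[OF distortion_F_2[OF v(2)]]
    \<comment> \<open>The lengths \<open>s / 2\<close> and \<open>5 / 2 * s\<close> have ratio
      \<open>1 / 5\<close>; distortion 2 leaves \<open>1 / 10\<close> for the images.\<close>
    have "?W (F k (x + 5 / 4 * s)) - ?W (F k (x - 5 / 4 * s))
      \<le> 6 / (p\<^sup>2 * (1 / 10)) * (?W (F k (y + s / 4)) - ?W (F k (y - s / 4)))"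
    proof (rule warp_quasisymmetric)
      have "(F k (ctr v) - F k (ctr v - d v)) * ((ctr v + d v) - ctr v)
          \<le> 2 * (F k (ctr v + d v) - F k (ctr v)) * (ctr v - (ctr v - d v))"
        by (rule dist) (use dv in auto)
      then show "F k (ctr v) - F k (ctr v - d v) \<le> 2 * (F k (ctr v + d v) - F k (ctr v))" using dv by simp
      have "(F k (ctr v + d v) - F k (ctr v)) * (ctr v - (ctr v - d v))
          \<le> 2 * (F k (ctr v) - F k (ctr v - d v)) * ((ctr v + d v) - ctr v)"
        by (rule dist) (use dv in auto)
      then show "F k (ctr v + d v) - F k (ctr v) \<le> 2 * (F k (ctr v) - F k (ctr v - d v))" using dv by simp
      have "(F k (x + 5 / 4 * s) - F k (x - 5 / 4 * s)) * ((y + s / 4) - (y - s / 4))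
         \<le> 2 * (F k (y + s / 4) - F k (y - s / 4)) * ((x + 5 / 4 * s) - (x - 5 / 4 * s))"
        by (rule dist)
          (use s y xc[of "x + 5 / 4 * s"] xc[of "x - 5 / 4 * s"] xc[of "y + s / 4"] xc[of "y - s / 4"] dv
            in auto)
      then have "(F k (x + 5 / 4 * s) - F k (x - 5 / 4 * s)) * (s / 2)
         \<le> (2 * (F k (y + s / 4) - F k (y - s / 4)) * 5) * (s / 2)" by (simp add: algebra_simps)
      then show "1 / 10 * (F k (x + 5 / 4 * s) - F k (x - 5 / 4 * s)) \<le> F k (y + s / 4) - F k (y - s / 4)"
        using s by simp
    qed (use p s y dv in auto)
    then have "F (Suc k) (x + 5 / 4 * s) - F (Suc k) (x - 5 / 4 * s)
        \<le> 60 / p\<^sup>2 * (F (Suc k) (y + s / 4) - F (Suc k) (y - s / 4))"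
      using s y by (simp add: Sk)
    moreover have "\<not> act j" if "Suc k \<le> j" for j using max[of j] that by auto
    ultimately show ?thesis using v by (intro exI[of _ "Suc k"]) auto
  qed
  then obtain n where n: "n \<le> N" "\<And>j. j \<ge> n \<Longrightarrow> \<not> act j"
     "F n (x + 5 / 4 * s) - F n (x - 5 / 4 * s) \<le> 60 / p\<^sup>2 * (F n (y + s / 4) - F n (y - s / 4))"
    by blast
  have "60 / p\<^sup>2 * (F n (y + s / 4) - F n (y - s / 4)) \<le> 60 / p\<^sup>2 * (F N (y + s / 2) - F N (y - s / 2))"
    using disp(2)[OF n(1,2)] p2 by (intro mult_left_mono) auto
  then show ?thesis using disp(1)[OF n(1,2)] n(3) by linarith
qed

end

subsection \<open>Quasisymmetric distribution functions\<close>

definition quasisymmetric :: "real \<Rightarrow> (real \<Rightarrow> real) \<Rightarrow> bool" where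
  "quasisymmetric M f \<longleftrightarrow> (\<forall>x s. 0 < s \<longrightarrow> f (x + s) - f (x - s) \<le> M * (f x - f (x - s)) \<and>
      f (x + s) - f (x - s) \<le> M * (f (x + s) - f x))"

text \<open>The large interval splits at \<open>x\<close> into two halves, each dominated by its own
  inner half.\<close>

lemma quasisymmetric_double:
  assumes "quasisymmetric M f" "0 < s"
  shows "f (x + 2 * s) - f (x - 2 * s) \<le> M * (f (x + s) - f (x - s))"
proof -
  have "f ((x + s) + s) - f ((x + s) - s) \<le> M * (f (x + s) - f ((x + s) - s))"
    using assms unfolding quasisymmetric_def by blast
  moreover have "f ((x - s) + s) - f ((x - s) - s) \<le> M * (f ((x - s) + s) - f (x - s))"
    using assms unfolding quasisymmetric_def by blast
  ultimately show ?thesis by (simp add: algebra_simps)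
qed

lemma quasisymmetric_power:
  assumes "quasisymmetric M f" "0 < s" "0 \<le> M"
  shows "f (x + 2 ^ k * s) - f (x - 2 ^ k * s) \<le> M ^ k * (f (x + s) - f (x - s))"
proof (induction k)
  case (Suc k)
  have "f (x + 2 * (2 ^ k * s)) - f (x - 2 * (2 ^ k * s)) \<le> M * (f (x + 2 ^ k * s) - f (x - 2 ^ k * s))"
    using assms by (intro quasisymmetric_double) auto
  also have "\<dots> \<le> M * (M ^ k * (f (x + s) - f (x - s)))"
    using Suc assms by (intro mult_left_mono) auto
  finally show ?case by (simp add: mult_ac)
qed simp

text \<open>The outer half of \<open>[x, x + 2 * s]\<close> carries at least the fraction
  \<open>1 / M\<close>, which leaves \<open>1 - 1 / M\<close> to the inner half.\<close>

lemma quasisymmetric_decay: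
  assumes f: "quasisymmetric M f" and "1 \<le> M" "0 < s"
  shows "f (x + s) - f x \<le> (1 - 1 / M) ^ k * (f (x + 2 ^ k * s) - f x)"
  using \<open>0 < s\<close>
proof (induction k arbitrary: s)
  case (Suc k)
  have "f ((x + s) + s) - f ((x + s) - s) \<le> M * (f ((x + s) + s) - f (x + s))"
    using f Suc.prems unfolding quasisymmetric_def by blast
  then have "f (x + s) - f x \<le> (1 - 1 / M) * (f (x + 2 * s) - f x)"
    using \<open>1 \<le> M\<close> by (simp add: field_simps)
  also have "\<dots> \<le> (1 - 1 / M) * ((1 - 1 / M) ^ k * (f (x + 2 ^ k * (2 * s)) - f x))"
    using \<open>1 \<le> M\<close> Suc.prems by (intro mult_left_mono Suc.IH) auto
  finally show ?case by (simp add: mult_ac)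
qed simp

text \<open>Comparing the scale \<open>1 / 2 ^ k\<close> with the scale 1 makes the increments on
  both sides of \<open>x\<close> geometrically small.\<close>

lemma quasisymmetric_continuous:
  assumes f: "quasisymmetric M f" and "1 \<le> M" and mono: "mono f"
  shows "isCont f x"
  unfolding continuous_at_eps_delta
proof (intro allI impI)
  fix e :: real assume "0 < e"
  define q where "q = 1 - 1 / M"
  have q: "0 \<le> q" "q < 1" using \<open>1 \<le> M\<close> by (auto simp: q_def)
  define A where "A = f (x + 1) - f (x - 1)"
  have A: "0 \<le> A" using monoD[OF mono, of "x - 1" "x + 1"] by (simp add: A_def)
  have "(\<lambda>k. q ^ k * A) \<longlonglongrightarrow> 0 * A" using q by (intro tendsto_mult LIMSEQ_realpow_zero) auto
  then have "eventually (\<lambda>k. q ^ k * A < e) sequentially" using \<open>0 < e\<close> by (intro order_tendstoD) auto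
  then obtain k where k: "q ^ k * A < e" by (auto simp: eventually_sequentially)
  define s :: real where "s = 1 / 2 ^ k"
  have s: "0 < s" "2 ^ k * s = 1" "s \<le> 1" by (auto simp: s_def)
  have "f (x + s) - f x \<le> q ^ k * (f (x + 1) - f x)"
    using quasisymmetric_decay[OF f \<open>1 \<le> M\<close> s(1), of x k] s by (simp add: q_def)
  also have "\<dots> \<le> q ^ k * A" unfolding A_def using q monoD[OF mono, of "x - 1" x] by (intro mult_left_mono) auto
  finally have r: "f (x + s) - f x < e" using k by simp
  have "f x - f (x - s) \<le> q ^ k * (f (x - s + 1) - f (x - s))"
    using quasisymmetric_decay[OF f \<open>1 \<le> M\<close> s(1), of "x - s" k] s by (simp add: q_def)
  also have "\<dots> \<le> q ^ k * A"
    unfolding A_def using q monoD[OF mono, of "x - 1" "x - s"] monoD[OF mono, of "x - s + 1" "x + 1"] s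
    by (intro mult_left_mono) auto
  finally have l: "f x - f (x - s) < e" using k by simp
  have "dist (f y) (f x) < e" if "dist y x < s" for y
    using that l r monoD[OF mono, of "x - s" y] monoD[OF mono, of y "x + s"]
    by (auto simp: dist_real_def abs_less_iff)
  then show "\<exists>d>0. \<forall>y. dist y x < d \<longrightarrow> dist (f y) (f x) < e" using s by blast
qed

text \<open>Flatness on one interval would spread to all its concentric dilates by
  \<open>quasisymmetric_power\<close>, against \<open>unb\<close>.\<close>

lemma quasisymmetric_strict_mono:
  assumes f: "quasisymmetric M f" and "1 \<le> M" and mono: "mono f" and unb: "\<And>x. \<exists>y>x. f x < f y" and "x < y"
  shows "f x < f y"
proof (rule ccontr)
  assume "\<not> f x < f y"
  then have eq: "f y = f x" using monoD[OF mono, of x y] \<open>x < y\<close> by simp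
  define m s where "m = (x + y) / 2" and "s = (y - x) / 2"
  have s: "0 < s" "m + s = y" "m - s = x" using \<open>x < y\<close> by (auto simp: m_def s_def field_simps)
  obtain z where z: "m < z" "f m < f z" using unb[of m] by auto
  obtain k :: nat where "(z - m) / s < 2 ^ k" using real_arch_pow[of 2 "(z - m) / s"] by auto
  then have k: "z < m + 2 ^ k * s" using s by (simp add: field_simps)
  have "f (m + 2 ^ k * s) - f (m - 2 ^ k * s) \<le> M ^ k * (f (m + s) - f (m - s))"
    using \<open>1 \<le> M\<close> s by (intro quasisymmetric_power[OF f]) auto
  then have "f (m + 2 ^ k * s) \<le> f (m - 2 ^ k * s)" using s eq by simp
  also have "\<dots> \<le> f m" using s by (intro monoD[OF mono]) auto
  also have "\<dots> < f z" by fact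
  also have "\<dots> \<le> f (m + 2 ^ k * s)" using k by (intro monoD[OF mono]) auto
  finally show False by simp
qed

section \<open>From quasisymmetric functions to doubling measures\<close>

lemma emeasure_interval_measure_Ioo:
  assumes "\<And>x y. x \<le> y \<Longrightarrow> f x \<le> f y" "\<And>x. isCont f x" "a \<le> b"
  shows "emeasure (interval_measure f) {a<..<b} = ennreal (f b - f a)"
proof -
  have cont: "continuous (at_right x) f" for x using assms(2) by (rule continuous_at_imp_continuous_within)
  have "emeasure (interval_measure f) {b} = 0"
    using emeasure_interval_measure_Icc[of b b f] assms by (simp add: continuous_at_imp_continuous_on)
  then have "{b} \<in> null_sets (interval_measure f)" by (simp add: null_sets_def)
  then have "emeasure (interval_measure f) ({a<..b} - {b}) = emeasure (interval_measure f) {a<..b}"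
    by (intro emeasure_Diff_null_set) auto
  moreover have "{a<..b} - {b} = {a<..<b}" by auto
  ultimately show ?thesis using emeasure_interval_measure_Ioc[OF \<open>a \<le> b\<close> assms(1) cont] by simp
qed

lemma doubling_measure_interval_measure:
  assumes f: "quasisymmetric M f" and "1 \<le> M" and mono: "mono f" and unb: "\<And>x. \<exists>y>x. f x < f y"
  shows "doubling_measure (interval_measure f)"
proof -
  have e: "emeasure (interval_measure f) (ball x r) = ennreal (f (x + r) - f (x - r))" if "0 < r" for x r
    using that emeasure_interval_measure_Ioo[of f "x - r" "x + r"] monoD[OF mono]
      quasisymmetric_continuous[OF f \<open>1 \<le> M\<close> mono] by (simp add: ball_eq_greaterThanLessThan)
  have pos: "0 < f (x + r) - f (x - r)" if "0 < r" for x r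
    using quasisymmetric_strict_mono[OF f \<open>1 \<le> M\<close> mono unb, of "x - r" "x + r"] that by simp
  have "ennreal (f (x + 2 * r) - f (x - 2 * r)) \<le> ennreal M * ennreal (f (x + r) - f (x - r))" if "0 < r" for x r
    using quasisymmetric_double[OF f that, of x] pos[OF that, of x] \<open>1 \<le> M\<close>
    by (subst ennreal_mult[symmetric]) (auto intro: ennreal_leI)
  then show ?thesis
    unfolding doubling_measure_def by (intro conjI exI[of _ M] allI impI)
      (use pos[of "2 * _"] in \<open>auto simp: e simp del: diff_gt_0_iff_gt\<close>)
qed

subsection \<open>The limit measure\<close>

context sparse_cantor_tree
begin

section \<open>Uniform quasisymmetry and convergence of the distribution functions\<close>

definition M :: real where "M = 60 / p\<^sup>2"

lemma M_ge_1: "1 \<le> M"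
proof -
  have "0 < p\<^sup>2" "p\<^sup>2 \<le> 1" using p by (auto simp: power_le_one)
  then show ?thesis by (simp add: M_def field_simps)
qed

lemma quasisymmetric_F: "quasisymmetric M (F n)"
  unfolding quasisymmetric_def
proof (intro allI impI)
  fix x s :: real assume "0 < s"
  then show "F n (x + s) - F n (x - s) \<le> M * (F n x - F n (x - s)) \<and>
      F n (x + s) - F n (x - s) \<le> M * (F n (x + s) - F n x)"
    using F_doubling[of s x "x - s / 2" n] F_doubling[of s x "x + s / 2" n]
    by (simp add: M_def[symmetric] add.commute)
qed

lemma F_beyond: "R \<le> \<bar>x\<bar> \<Longrightarrow> F n x = x"
proof -
  assume x: "R \<le> \<bar>x\<bar>"
  have "F n x = F 0 x"
  proof (rule F_unchanged, simp, rule ccontr)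
    fix j v assume v: "v \<in> T j" "\<not> d v \<le> \<bar>x - ctr v\<bar>"
    then have "lo v < x" "x < hi v" using near_interior[of v j x] by auto
    then show False using bounded_nodes[OF v(1)] x by auto
  qed
  then show ?thesis by simp
qed

text \<open>Of the factor \<open>\<delta>\<close> per generation only \<open>1 / 2\<close> is kept,
  to match the doublings in \<open>quasisymmetric_decay\<close>.\<close>

lemma length_le: "v \<in> T n \<Longrightarrow> 2 ^ n * (hi v - lo v) \<le> 2 * R"
proof (induction n arbitrary: v)
  case 0
  then show ?case using bounded_nodes[OF 0] by simp
next
  case (Suc n)
  obtain w where w: "w \<in> T n" "hi v - lo v \<le> \<delta> * (hi w - lo w)" using nested[OF Suc.prems] by blast
  have "\<delta> * (hi w - lo w) \<le> 1 / 2 * (hi w - lo w)"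
    using \<delta> lo_less_hi[OF w(1)] by (intro mult_right_mono) auto
  then have "2 * (hi v - lo v) \<le> hi w - lo w" using w by simp
  then have "2 ^ n * (2 * (hi v - lo v)) \<le> 2 ^ n * (hi w - lo w)" by (intro mult_left_mono) auto
  also have "\<dots> \<le> 2 * R" using Suc.IH[OF w(1)] .
  finally show ?case by (simp add: mult.assoc[symmetric] mult.commute)
qed

text \<open>The ends of a node of generation \<open>k\<close> no longer move, so a point inside
  moves by at most the mass of the node. After \<open>k\<close> doublings the node still fits into
  \<open>[- R, 3 * R]\<close>, of mass \<open>4 * R\<close>, and each doubling gains the factor
  \<open>1 - 1 / M\<close>.\<close>

lemma F_Cauchy_bound:
  assumes "k \<le> N"
  shows "\<bar>F N x - F k x\<bar> \<le> (1 - 1 / M) ^ k * (4 * R)"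
proof (cases "\<exists>v\<in>T k. lo v < x \<and> x < hi v")
  case False
  then have "F N x = F k x" using F_stable[OF assms, of x] by blast
  then show ?thesis using M_ge_1 R by (simp add: zero_le_power)
next
  case True
  then obtain v where v: "v \<in> T k" "lo v < x" "x < hi v" by auto
  define L where "L = hi v - lo v"
  have "F k (lo v + L) - F k (lo v) \<le> (1 - 1 / M) ^ k * (F k (lo v + 2 ^ k * L) - F k (lo v))"
    using v by (intro quasisymmetric_decay quasisymmetric_F M_ge_1) (auto simp: L_def)
  also have "\<dots> \<le> (1 - 1 / M) ^ k * (F k (3 * R) - F k (- R))"
  proof (intro mult_left_mono)
    have "F k (lo v + 2 ^ k * L) \<le> F k (3 * R)" "F k (- R) \<le> F k (lo v)"
      using length_le[OF v(1)] bounded_nodes[OF v(1)] v by (auto simp: L_def)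
    then show "F k (lo v + 2 ^ k * L) - F k (lo v) \<le> F k (3 * R) - F k (- R)" by linarith
    show "0 \<le> (1 - 1 / M) ^ k" using M_ge_1 by (intro zero_le_power) simp
  qed
  also have "F k (3 * R) - F k (- R) = 4 * R" using R by (simp add: F_beyond)
  finally have w: "F k (hi v) - F k (lo v) \<le> (1 - 1 / M) ^ k * (4 * R)" by (simp add: L_def)
  have "F N (lo v) = F k (lo v)" "F N (hi v) = F k (hi v)"
    using F_endpoint[OF v(1) assms] by auto
  moreover have "F N (lo v) < F N x" "F N x < F N (hi v)" "F k (lo v) < F k x" "F k x < F k (hi v)"
    using v by auto
  ultimately show ?thesis using w by linarith
qed

definition G :: "real \<Rightarrow> real" where
  "G x = lim (\<lambda>n. F n x)"

lemma F_tendsto_G: "(\<lambda>n. F n x) \<longlonglongrightarrow> G x"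
proof -
  have q: "0 \<le> 1 - 1 / M" "1 - 1 / M < 1" using M_ge_1 by auto
  have "Cauchy (\<lambda>n. F n x)"
  proof (rule metric_CauchyI)
    fix e :: real assume "0 < e"
    have "(\<lambda>k. (1 - 1 / M) ^ k * (4 * R)) \<longlonglongrightarrow> 0 * (4 * R)"
      using q by (intro tendsto_mult LIMSEQ_realpow_zero) auto
    then have "eventually (\<lambda>k. (1 - 1 / M) ^ k * (4 * R) < e / 2) sequentially"
      using \<open>0 < e\<close> by (intro order_tendstoD) auto
    then obtain k where k: "(1 - 1 / M) ^ k * (4 * R) < e / 2" by (auto simp: eventually_sequentially)
    have "dist (F m x) (F n x) < e" if "k \<le> m" "k \<le> n" for m n
      using F_Cauchy_bound[OF that(1), of x] F_Cauchy_bound[OF that(2), of x] k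
      by (auto simp: dist_real_def abs_le_iff abs_less_iff)
    then show "\<exists>k. \<forall>m\<ge>k. \<forall>n\<ge>k. dist (F m x) (F n x) < e" by blast
  qed
  then have "convergent (\<lambda>n. F n x)" by (rule Cauchy_convergent)
  then show ?thesis unfolding G_def by (simp add: convergent_LIMSEQ_iff)
qed

lemma G_eqI:
  assumes "\<And>N. n \<le> N \<Longrightarrow> F N x = c"
  shows "G x = c"
proof -
  have "(\<lambda>N. F N x) \<longlonglongrightarrow> c"
    by (rule tendsto_eventually) (auto simp: eventually_sequentially intro!: exI[of _ n] assms)
  then show ?thesis using F_tendsto_G LIMSEQ_unique by blast
qed

lemma G_beyond: "R \<le> \<bar>x\<bar> \<Longrightarrow> G x = x"
  using F_beyond by (intro G_eqI) auto

lemma mono_G: "mono G"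
proof (rule monoI)
  fix x y :: real assume "x \<le> y"
  then show "G x \<le> G y" by (intro LIMSEQ_le[OF F_tendsto_G F_tendsto_G]) auto
qed

lemma quasisymmetric_G: "quasisymmetric M G"
  unfolding quasisymmetric_def
proof (intro allI impI conjI)
  fix x s :: real assume s: "0 < s"
  show "G (x + s) - G (x - s) \<le> M * (G x - G (x - s))"
    by (rule LIMSEQ_le[OF tendsto_diff[OF F_tendsto_G F_tendsto_G]
          tendsto_mult_left[OF tendsto_diff[OF F_tendsto_G F_tendsto_G]]])
      (use quasisymmetric_F s in \<open>auto simp: quasisymmetric_def\<close>)
  show "G (x + s) - G (x - s) \<le> M * (G (x + s) - G x)"
    by (rule LIMSEQ_le[OF tendsto_diff[OF F_tendsto_G F_tendsto_G]
          tendsto_mult_left[OF tendsto_diff[OF F_tendsto_G F_tendsto_G]]])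
      (use quasisymmetric_F s in \<open>auto simp: quasisymmetric_def\<close>)
qed

lemma G_unbounded: "\<exists>y>x. G x < G y"
proof -
  define y where "y = max R (max x (G x)) + 1"
  have "G y = y" using R by (intro G_beyond) (auto simp: y_def)
  then show ?thesis by (intro exI[of _ y]) (auto simp: y_def)
qed

lemma isCont_G: "isCont G x"
  using quasisymmetric_continuous[OF quasisymmetric_G M_ge_1 mono_G] .

lemma doubling_measure_G: "doubling_measure (interval_measure G)"
  using doubling_measure_interval_measure[OF quasisymmetric_G M_ge_1 mono_G G_unbounded] .

text \<open>The profile sends a relative size \<open>t / D\<close> to about its \<open>p\<close>-th
  power, and \<open>t / D \<ge> \<kappa> n / 2\<close> by distortion 2. The mass is final after
  generation \<open>n\<close>, and \<open>c\<close> is uniform over all nodes.\<close>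

lemma G_hole_mass:
  obtains c where "0 < c"
    "\<And>n v. v \<in> T n \<Longrightarrow> c * \<kappa> n powr p * (G (hi v) - G (lo v)) \<le> G (ctr v + \<kappa> n * d v) - G (ctr v - \<kappa> n * d v)"
proof -
  obtain K :: nat where K: "1 / \<delta> < 2 ^ K" using real_arch_pow[of 2 "1 / \<delta>"] by auto
  \<comment> \<open>\<open>K\<close> doublings lead from radius \<open>d v\<close> to the length of
    the node, and one more factor \<open>M\<close> passes to the right half, of mass
    \<open>D\<close>.\<close>
  define c where "c = p / 2 / M ^ Suc K"
  have M0: "0 < M" using M_ge_1 by linarith
  have "0 < c" unfolding c_def using p M0 by (intro divide_pos_pos zero_less_power) auto
  moreover have "c * \<kappa> n powr p * (G (hi v) - G (lo v)) \<le> G (ctr v + \<kappa> n * d v) - G (ctr v - \<kappa> n * d v)"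
    if v: "v \<in> T n" for n v
  proof -
    define h where "h = \<kappa> n * d v"
    have dv: "0 < d v" using d_pos v by simp
    have h: "0 < h" "h < d v" using \<kappa>[of n] dv by (auto simp: h_def)
    \<comment> \<open>Nodes of the next generation avoid the hole, so later warps fix both
      points.\<close>
    have G_hole: "G x = F (Suc n) x" if "x = ctr v + h \<or> x = ctr v - h" for x
    proof (rule G_eqI[of "Suc n"], erule F_stable)
      fix w assume w: "w \<in> T (Suc n)"
      show "\<not> (lo w < x \<and> x < hi w)"
      proof
        assume x: "lo w < x \<and> x < hi w"
        have xv: "lo v < x" "x < hi v" using near_interior[OF v, of x] that h by auto
        have "hi w \<le> ctr v - h \<or> ctr v + h \<le> lo w"
          unfolding h_def by (rule ancestor_of_point(5)[OF w v _ _ _ xv]) (use x in auto)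
        then show False using x that h by auto
      qed
    qed
    have G_end: "G x = F n x" if "x = lo v \<or> x = hi v" for x
      by (rule G_eqI[of n], rule F_endpoint[OF v _ that])
    define D t where "D = F n (ctr v + d v) - F n (ctr v)" and "t = F n (ctr v + h) - F n (ctr v)"
    have D: "0 < t" "t \<le> D" "0 < D" using h dv by (auto simp: D_def t_def)
    have "D * (ctr v + h - ctr v) \<le> 2 * t * (ctr v + d v - ctr v)"
      unfolding D_def t_def by (rule distortion_leD[OF distortion_F_2[OF v]]) (use h dv in auto)
    then have "\<kappa> n / 2 \<le> t / D" using D dv by (simp add: h_def field_simps)
    then have "(\<kappa> n / 2) powr p \<le> (t / D) powr p" using p \<kappa>[of n] by (intro powr_mono2) auto
    moreover have "\<kappa> n powr p / 2 \<le> (\<kappa> n / 2) powr p"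
    proof -
      have "2 powr p \<le> (2::real) powr 1" using p by (intro powr_mono) auto
      then have "\<kappa> n powr p / 2 \<le> \<kappa> n powr p / 2 powr p" by (intro divide_left_mono) auto
      then show ?thesis using \<kappa>[of n] by (simp add: powr_divide)
    qed
    ultimately have tD: "\<kappa> n powr p / 2 \<le> (t / D) powr p" by linarith
    have "L \<le> M ^ Suc K * D" if L: "L = F n (hi v) - F n (lo v)" for L
    proof -
      have "1 \<le> 2 ^ K * \<delta>" using K \<delta> by (simp add: field_simps)
      then have "1 * (hi v - lo v) \<le> (2 ^ K * \<delta>) * (hi v - lo v)"
        using lo_less_hi[OF v] by (intro mult_right_mono) auto
      then have "hi v - lo v \<le> 2 ^ K * d v" by (simp add: d_def mult_ac)
      then have "F n (hi v) \<le> F n (ctr v + 2 ^ K * d v)" "F n (ctr v - 2 ^ K * d v) \<le> F n (lo v)"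
        using ctr_bounds[OF v] dv by auto
      then have "L \<le> F n (ctr v + 2 ^ K * d v) - F n (ctr v - 2 ^ K * d v)" using L by linarith
      also have "\<dots> \<le> M ^ K * (F n (ctr v + d v) - F n (ctr v - d v))"
        using dv M0 by (intro quasisymmetric_power quasisymmetric_F) auto
      also have "\<dots> \<le> M ^ K * (M * D)"
        using quasisymmetric_F[of n] dv M0 unfolding quasisymmetric_def D_def
        by (intro mult_left_mono zero_le_power) auto
      finally show ?thesis by (simp add: mult_ac)
    qed
    then have L: "(G (hi v) - G (lo v)) / M ^ Suc K \<le> D"
      using M0 by (subst pos_divide_le_eq) (auto simp: G_end mult.commute intro!: zero_less_power)
    have "c * \<kappa> n powr p * (G (hi v) - G (lo v)) = p * (\<kappa> n powr p / 2) * ((G (hi v) - G (lo v)) / M ^ Suc K)"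
      by (simp add: c_def)
    also have "\<dots> \<le> p * (\<kappa> n powr p / 2) * D" using p L by (intro mult_left_mono) auto
    also have "\<dots> \<le> p * (t / D) powr p * D" using p tD D by (intro mult_right_mono mult_left_mono) auto
    also have "\<dots> \<le> prof p D t" using p D by (intro prof_ge_power) auto
    also have "\<dots> = F (Suc n) (ctr v + h) - F n (ctr v)"
    proof -
      have i: "lo v < ctr v + h" "ctr v + h < hi v" using near_interior[OF v, of "ctr v + h"] h by auto
      show ?thesis using h by (simp add: F_Suc_interior[OF v i] warp_def D_def t_def)
    qed
    also have "F n (ctr v) = F (Suc n) (ctr v)"
    proof -
      have i: "lo v < ctr v" "ctr v < hi v" using near_interior[OF v, of "ctr v"] dv by auto
      show ?thesis by (simp add: F_Suc_interior[OF v i])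
    qed
    also have "F (Suc n) (ctr v + h) - F (Suc n) (ctr v) \<le> F (Suc n) (ctr v + h) - F (Suc n) (ctr v - h)"
      using h by simp
    also have "\<dots> = G (ctr v + \<kappa> n * d v) - G (ctr v - \<kappa> n * d v)" using G_hole by (simp add: h_def)
    finally show ?thesis .
  qed
  ultimately show ?thesis using that by blast
qed

section \<open>Mass of the generations\<close>

lemma countable_nodes: "countable (T n)"
proof -
  have "\<forall>v\<in>T n. \<exists>q::rat. lo v < of_rat q \<and> of_rat q < hi v"
    using of_rat_dense lo_less_hi by blast
  then obtain q :: "'v \<Rightarrow> rat" where q: "\<And>v. v \<in> T n \<Longrightarrow> lo v < of_rat (q v) \<and> of_rat (q v) < hi v"
    by (metis bchoice)
  have "inj_on q (T n)"
    by (rule inj_onI) (metis q same_node)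
  then show ?thesis using countable_image_inj_on[of q "T n"] by blast
qed

lemma emeasure_G_Ioc: "a \<le> b \<Longrightarrow> emeasure (interval_measure G) {a<..b} = ennreal (G b - G a)"
  using monoD[OF mono_G] isCont_G by (intro emeasure_interval_measure_Ioc) (auto intro: continuous_at_imp_continuous_within)

text \<open>Each node loses at least the fraction \<open>c * \<kappa> n powr p\<close>, and
  \<open>1 - y \<le> exp (- y)\<close>. Half-open intervals keep neighbouring nodes disjoint; the
  sum over nodes is an integral for counting measure.\<close>

lemma emeasure_G_generation_step:
  assumes c: "0 < c" "\<And>n v. v \<in> T n \<Longrightarrow>
      c * \<kappa> n powr p * (G (hi v) - G (lo v)) \<le> G (ctr v + \<kappa> n * d v) - G (ctr v - \<kappa> n * d v)"
  shows "emeasure (interval_measure G) (\<Union>v\<in>T (Suc n). {lo v<..hi v})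
    \<le> ennreal (exp (- c * \<kappa> n powr p)) * emeasure (interval_measure G) (\<Union>v\<in>T n. {lo v<..hi v})"
proof -
  let ?\<mu> = "interval_measure G"
  let ?X = "\<lambda>v. {lo v<..hi v}" and ?J = "\<lambda>v. {ctr v - \<kappa> n * d v<..ctr v + \<kappa> n * d v}"
  have disj: "disjoint_family_on ?X (T n)"
    using separated by (fastforce simp: disjoint_family_on_def)
  then have disj': "disjoint_family_on (\<lambda>v. ?X v - ?J v) (T n)"
    by (fastforce simp: disjoint_family_on_def)
  have "(\<Union>v\<in>T (Suc n). ?X v) \<subseteq> (\<Union>v\<in>T n. ?X v - ?J v)"
  proof
    fix x assume "x \<in> (\<Union>v\<in>T (Suc n). ?X v)"
    then obtain v where v: "v \<in> T (Suc n)" "lo v < x" "x \<le> hi v" by auto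
    obtain w where "w \<in> T n" "lo w \<le> lo v" "hi v \<le> hi w" "hi v \<le> ctr w - \<kappa> n * d w \<or> ctr w + \<kappa> n * d w \<le> lo v"
      using ancestor[OF v(1), of n] by auto
    then show "x \<in> (\<Union>v\<in>T n. ?X v - ?J v)" using v by (intro UN_I[of w]) auto
  qed
  then have "emeasure ?\<mu> (\<Union>v\<in>T (Suc n). ?X v) \<le> emeasure ?\<mu> (\<Union>v\<in>T n. ?X v - ?J v)"
    using countable_nodes by (intro emeasure_mono) auto
  also have "\<dots> = (\<integral>\<^sup>+v. emeasure ?\<mu> (?X v - ?J v) \<partial>count_space (T n))"
    using countable_nodes disj' by (intro emeasure_UN_countable) auto
  also have "\<dots> \<le> (\<integral>\<^sup>+v. ennreal (exp (- c * \<kappa> n powr p)) * emeasure ?\<mu> (?X v) \<partial>count_space (T n))"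
  proof (rule nn_integral_mono)
    fix v assume "v \<in> space (count_space (T n))"
    then have v: "v \<in> T n" by simp
    have dv: "0 < d v" using d_pos v by simp
    have kd: "0 < \<kappa> n * d v" "\<kappa> n * d v < d v" using \<kappa>[of n] dv by auto
    have sub: "?J v \<subseteq> ?X v" using ctr_bounds[OF v] kd by auto
    have le: "lo v \<le> hi v" using lo_less_hi[OF v] by simp
    have G: "0 \<le> G (hi v) - G (lo v)" using monoD[OF mono_G le] by simp
    have "emeasure ?\<mu> (?X v - ?J v) = emeasure ?\<mu> (?X v) - emeasure ?\<mu> (?J v)"
      using sub kd emeasure_G_Ioc[of "ctr v - \<kappa> n * d v" "ctr v + \<kappa> n * d v"] by (intro emeasure_Diff) auto
    also have "\<dots> = ennreal ((G (hi v) - G (lo v)) - (G (ctr v + \<kappa> n * d v) - G (ctr v - \<kappa> n * d v)))"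
      using emeasure_G_Ioc[of "ctr v - \<kappa> n * d v" "ctr v + \<kappa> n * d v"] emeasure_G_Ioc[OF le] kd
        monoD[OF mono_G, of "ctr v - \<kappa> n * d v" "ctr v + \<kappa> n * d v"]
      by (simp add: ennreal_minus)
    also have "\<dots> \<le> ennreal (exp (- c * \<kappa> n powr p) * (G (hi v) - G (lo v)))"
    proof (rule ennreal_leI)
      have "(1 + (- c * \<kappa> n powr p)) * (G (hi v) - G (lo v)) \<le> exp (- c * \<kappa> n powr p) * (G (hi v) - G (lo v))"
        using G by (intro mult_right_mono exp_ge_add_one_self)
      then show "(G (hi v) - G (lo v)) - (G (ctr v + \<kappa> n * d v) - G (ctr v - \<kappa> n * d v))
          \<le> exp (- c * \<kappa> n powr p) * (G (hi v) - G (lo v))"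
        using c(2)[OF v] by (simp add: algebra_simps)
    qed
    also have "\<dots> = ennreal (exp (- c * \<kappa> n powr p)) * emeasure ?\<mu> (?X v)"
      using emeasure_G_Ioc[OF le] G by (simp add: ennreal_mult)
    finally show "emeasure ?\<mu> (?X v - ?J v) \<le> ennreal (exp (- c * \<kappa> n powr p)) * emeasure ?\<mu> (?X v)" .
  qed
  also have "\<dots> = ennreal (exp (- c * \<kappa> n powr p)) * (\<integral>\<^sup>+v. emeasure ?\<mu> (?X v) \<partial>count_space (T n))"
    by (rule nn_integral_cmult) auto
  also have "(\<integral>\<^sup>+v. emeasure ?\<mu> (?X v) \<partial>count_space (T n)) = emeasure ?\<mu> (\<Union>v\<in>T n. ?X v)"
    using countable_nodes disj by (intro emeasure_UN_countable[symmetric]) auto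
  finally show ?thesis .
qed

text \<open>The factors multiply to \<open>exp (- c * (\<Sum>k<n. \<kappa> k powr p))\<close>, with
  unbounded partial sums. Closed and half-open nodes differ by countably many left endpoints, a null
  set.\<close>

lemma null_of_not_summable:
  assumes ns: "\<not> summable (\<lambda>n. \<kappa> n powr p)" and S: "\<And>n. S \<subseteq> (\<Union>v\<in>T n. {lo v..hi v})"
  shows "emeasure (interval_measure G) S = 0"
proof -
  let ?\<mu> = "interval_measure G"
  let ?V = "\<lambda>n. \<Union>v\<in>T n. {lo v<..hi v}"
  obtain c where c: "0 < c" "\<And>n v. v \<in> T n \<Longrightarrow>
      c * \<kappa> n powr p * (G (hi v) - G (lo v)) \<le> G (ctr v + \<kappa> n * d v) - G (ctr v - \<kappa> n * d v)"
    using G_hole_mass by blast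
  have V: "emeasure ?\<mu> (?V n) \<le> ennreal (exp (- c * (\<Sum>k<n. \<kappa> k powr p)) * (2 * R))" for n
  proof (induction n)
    case 0
    have "emeasure ?\<mu> (?V 0) \<le> emeasure ?\<mu> {- R<..R}"
      using bounded_nodes[of _ 0] by (intro emeasure_mono) force+
    also have "\<dots> = ennreal (2 * R)" using R emeasure_G_Ioc[of "- R" R] by (simp add: G_beyond)
    finally show ?case by simp
  next
    case (Suc n)
    have "emeasure ?\<mu> (?V (Suc n)) \<le> ennreal (exp (- c * \<kappa> n powr p)) * emeasure ?\<mu> (?V n)"
      using emeasure_G_generation_step[OF c] .
    also have "\<dots> \<le> ennreal (exp (- c * \<kappa> n powr p)) * ennreal (exp (- c * (\<Sum>k<n. \<kappa> k powr p)) * (2 * R))"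
      using Suc by (intro mult_left_mono) auto
    also have "\<dots> = ennreal (exp (- c * (\<Sum>k<Suc n. \<kappa> k powr p)) * (2 * R))"
      using R by (simp add: ennreal_mult[symmetric] algebra_simps exp_add[symmetric] exp_diff)
    finally show ?case .
  qed
  have SV: "emeasure ?\<mu> S \<le> emeasure ?\<mu> (?V n)" for n
  proof -
    have "emeasure ?\<mu> {x} = 0" for x
      using emeasure_interval_measure_Icc[of x x G] monoD[OF mono_G] isCont_G
      by (simp add: continuous_at_imp_continuous_on)
    then have "(\<Union>v\<in>T n. {lo v}) \<in> null_sets ?\<mu>"
      using countable_nodes by (intro null_sets_UN') (auto simp: null_sets_def)
    then have "emeasure ?\<mu> (?V n \<union> (\<Union>v\<in>T n. {lo v})) = emeasure ?\<mu> (?V n)"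
      using countable_nodes by (intro emeasure_Un_null_set) auto
    moreover have "emeasure ?\<mu> S \<le> emeasure ?\<mu> (?V n \<union> (\<Union>v\<in>T n. {lo v}))"
      using S[of n] countable_nodes by (intro emeasure_mono) force+
    ultimately show ?thesis by simp
  qed
  have "emeasure ?\<mu> S \<le> 0"
  proof (rule ennreal_le_epsilon)
    fix e :: real assume "0 < e"
    \<comment> \<open>Solves \<open>exp (- c * B) = e / (2 * R)\<close>.\<close>
    define B where "B = ln (2 * R / e) / c"
    have "\<exists>n. B < (\<Sum>k<n. \<kappa> k powr p)"
    proof (rule ccontr)
      assume "\<nexists>n. B < (\<Sum>k<n. \<kappa> k powr p)"
      then have "summable (\<lambda>n. \<kappa> n powr p)" by (intro summableI_nonneg_bounded[of _ B]) (auto simp: not_less)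
      then show False using ns by simp
    qed
    then obtain n where n: "B < (\<Sum>k<n. \<kappa> k powr p)" by auto
    have "exp (- c * (\<Sum>k<n. \<kappa> k powr p)) \<le> exp (- c * B)" using c n by simp
    also have "\<dots> = e / (2 * R)" using c R \<open>0 < e\<close> by (simp add: B_def exp_minus)
    finally have "exp (- c * (\<Sum>k<n. \<kappa> k powr p)) * (2 * R) \<le> e" using R by (simp add: field_simps)
    then show "emeasure ?\<mu> S \<le> 0 + ennreal e" using SV[of n] V[of n] by (auto intro: order_trans ennreal_leI)
  qed
  then show ?thesis by simp
qed

end

subsection \<open>Nice porous Cantor sets\<close>

text \<open>Partial sums are grouped into blocks of length \<open>m\<close>, and the block sums add
  up the class series. Used in contrapositive form to find a divergent class.\<close>

lemma summable_residue_classes: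
  fixes f :: "nat \<Rightarrow> real"
  assumes "0 < m" and f: "\<And>n. 0 \<le> f n" and sm: "\<And>j. j < m \<Longrightarrow> summable (\<lambda>n. f (m * n + j))"
  shows "summable f"
proof -
  define g where "g k = (\<Sum>j<m. f (m * k + j))" for k
  have g: "summable g" unfolding g_def using sm by (intro summable_sum) auto
  have block: "sum f {k * m..<k * m + m} = g k" for k
    unfolding g_def by (rule sum.reindex_bij_witness[of _ "\<lambda>j. m * k + j" "\<lambda>i. i - m * k"]) (auto simp: mult.commute)
  show ?thesis
  proof (rule summableI_nonneg_bounded[OF f])
    fix n
    have "n \<le> n * m" using \<open>0 < m\<close> by simp
    then have "(\<Sum>i<n. f i) \<le> (\<Sum>i<n * m. f i)" using f by (intro sum_mono2) auto
    also have "\<dots> = (\<Sum>k<n. g k)" using sum.nat_group[of f m n] by (simp add: block)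
    also have "\<dots> \<le> suminf g" by (intro sum_le_suminf g) (auto simp: g_def f intro: sum_nonneg)
    finally show "(\<Sum>i<n. f i) \<le> suminf g" .
  qed
qed

lemma cantor_constructionD:
  assumes "cantor_construction K a b l r"
  shows "\<forall>n\<ge>1. \<forall>i\<in>K n. \<forall>j\<in>K n. i \<noteq> j \<longrightarrow> interior (Icl a b n i) \<inter> interior (Icl a b n j) = {}"
    and "\<forall>n\<ge>1. \<forall>i\<in>K n. Jop l r n i \<subseteq> Icl a b n i"
    and "\<forall>n\<ge>1. \<forall>i\<in>K (Suc n). \<exists>j\<in>K n. Icl a b (Suc n) i \<subseteq> Icl a b n j"
    and "\<forall>n\<ge>1. (\<Union>i\<in>K (Suc n). Icl a b (Suc n) i) = (\<Union>i\<in>K n. Icl a b n i) - (\<Union>i\<in>K n. Jop l r n i)"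
    and "bounded (\<Union>i\<in>K 1. Icl a b 1 i)"
  by (insert assms[unfolded cantor_construction_def]) (elim conjE, assumption)+

text \<open>Niceness makes the hole nonempty, hence all intervals nondegenerate; a point shared by
  the hole and the central part is the required \<open>z\<close>.\<close>

lemma nice_interval:
  assumes C: "cantor_construction K a b l r"
    and nice: "{(a n i + b n i) / 2 - c * (b n i - a n i) / 2 ..
            (a n i + b n i) / 2 + c * (b n i - a n i) / 2} \<inter> Jop l r n i \<noteq> {}"
    and "1 \<le> n" "i \<in> K n"
  shows "a n i < b n i" "a n i \<le> l n i" "l n i < r n i" "r n i \<le> b n i"
    "\<exists>z. l n i < z \<and> z < r n i \<and> (1 - c) / 2 * (b n i - a n i) \<le> z - a n i \<and> (1 - c) / 2 * (b n i - a n i) \<le> b n i - z"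
proof -
  from nice obtain z where z: "(a n i + b n i) / 2 - c * (b n i - a n i) / 2 \<le> z"
      "z \<le> (a n i + b n i) / 2 + c * (b n i - a n i) / 2" "l n i < z" "z < r n i"
    by (auto simp: Jop_def)
  then show lr: "l n i < r n i" by linarith
  have "Jop l r n i \<subseteq> Icl a b n i" using cantor_constructionD(2)[OF C] assms(3,4) by blast
  then show "a n i \<le> l n i" "r n i \<le> b n i" using lr
    by (auto simp: Jop_def Icl_def greaterThanLessThan_subseteq_atLeastAtMost_iff)
  then show "a n i < b n i" using lr by linarith
  show "\<exists>z. l n i < z \<and> z < r n i \<and> (1 - c) / 2 * (b n i - a n i) \<le> z - a n i \<and> (1 - c) / 2 * (b n i - a n i) \<le> b n i - z"
    using z by (intro exI[of _ z]) (auto simp: field_simps)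
qed

text \<open>A child misses the hole of its parent and therefore lies on one side of it. The point
  \<open>z\<close> of the hole leaves at most the fraction \<open>1 - (1 - c) / 2\<close> for that
  side.\<close>

lemma cantor_child:
  assumes C: "cantor_construction K a b l r"
    and nice: "\<And>n i. 1 \<le> n \<Longrightarrow> i \<in> K n \<Longrightarrow> {(a n i + b n i) / 2 - c * (b n i - a n i) / 2 ..
            (a n i + b n i) / 2 + c * (b n i - a n i) / 2} \<inter> Jop l r n i \<noteq> {}"
    and n: "1 \<le> n" "i \<in> K (Suc n)"
  shows "\<exists>j\<in>K n. a n j \<le> a (Suc n) i \<and> b (Suc n) i \<le> b n j \<and>
    b (Suc n) i - a (Suc n) i \<le> (1 + c) / 2 * (b n j - a n j) \<and> (b (Suc n) i \<le> l n j \<or> r n j \<le> a (Suc n) i)"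
proof -
  have lt: "a (Suc n) i < b (Suc n) i"
    using nice_interval(1)[OF C nice, of "Suc n" i] n by auto
  obtain j where j: "j \<in> K n" "Icl a b (Suc n) i \<subseteq> Icl a b n j"
    using cantor_constructionD(3)[OF C] n by blast
  have U: "(\<Union>i\<in>K (Suc n). Icl a b (Suc n) i) = (\<Union>i\<in>K n. Icl a b n i) - (\<Union>i\<in>K n. Jop l r n i)"
    using cantor_constructionD(4)[OF C] n by blast
  have disj: "Icl a b (Suc n) i \<inter> Jop l r n j = {}" using U n j by blast
  note J = nice_interval[OF C nice[OF n(1) j(1)] n(1) j(1)]
  have sub: "a n j \<le> a (Suc n) i" "b (Suc n) i \<le> b n j" using j lt by (auto simp: Icl_def)
  have side: "b (Suc n) i \<le> l n j \<or> r n j \<le> a (Suc n) i"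
  proof (rule ccontr)
    assume "\<not> ?thesis"
    then have less: "max (l n j) (a (Suc n) i) < min (r n j) (b (Suc n) i)" using J lt by auto
    define x where "x = (max (l n j) (a (Suc n) i) + min (r n j) (b (Suc n) i)) / 2"
    have "max (l n j) (a (Suc n) i) < x" "x < min (r n j) (b (Suc n) i)" using less by (auto simp: x_def)
    then have "x \<in> Icl a b (Suc n) i \<inter> Jop l r n j" by (auto simp: Icl_def Jop_def)
    then show False using disj by blast
  qed
  obtain z where z: "l n j < z" "z < r n j" "(1 - c) / 2 * (b n j - a n j) \<le> z - a n j" "(1 - c) / 2 * (b n j - a n j) \<le> b n j - z"
    using J(5) by blast
  have "(1 + c) / 2 * (b n j - a n j) = (b n j - a n j) - (1 - c) / 2 * (b n j - a n j)" by (simp add: field_simps)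
  then have "b (Suc n) i - a (Suc n) i \<le> (1 + c) / 2 * (b n j - a n j)" using side z sub by linarith
  then show ?thesis using j sub side by blast
qed

text \<open>Iterates \<open>cantor_child\<close>, with the side of the hole inherited from the first
  step; \<open>Suc m\<close> guarantees that there is one.\<close>

lemma cantor_descendant:
  assumes C: "cantor_construction K a b l r" and c: "0 < c"
    and nice: "\<And>n i. 1 \<le> n \<Longrightarrow> i \<in> K n \<Longrightarrow> {(a n i + b n i) / 2 - c * (b n i - a n i) / 2 ..
            (a n i + b n i) / 2 + c * (b n i - a n i) / 2} \<inter> Jop l r n i \<noteq> {}"
    and n: "1 \<le> n" "i \<in> K (n + Suc m)"
  shows "\<exists>j\<in>K n. a n j \<le> a (n + Suc m) i \<and> b (n + Suc m) i \<le> b n j \<and>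
    b (n + Suc m) i - a (n + Suc m) i \<le> ((1 + c) / 2) ^ Suc m * (b n j - a n j) \<and>
    (b (n + Suc m) i \<le> l n j \<or> r n j \<le> a (n + Suc m) i)"
  using n(2)
proof (induction m arbitrary: i)
  case 0
  then show ?case using cantor_child[OF C nice, of n i] n(1) by auto
next
  case (Suc m)
  have "\<exists>h\<in>K (n + Suc m). a (n + Suc m) h \<le> a (Suc (n + Suc m)) i \<and> b (Suc (n + Suc m)) i \<le> b (n + Suc m) h \<and>
    b (Suc (n + Suc m)) i - a (Suc (n + Suc m)) i \<le> (1 + c) / 2 * (b (n + Suc m) h - a (n + Suc m) h) \<and>
    (b (Suc (n + Suc m)) i \<le> l (n + Suc m) h \<or> r (n + Suc m) h \<le> a (Suc (n + Suc m)) i)"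
    using Suc.prems n(1) by (intro cantor_child[OF C nice]) auto
  then obtain h where h: "h \<in> K (n + Suc m)" "a (n + Suc m) h \<le> a (n + Suc (Suc m)) i"
      "b (n + Suc (Suc m)) i \<le> b (n + Suc m) h"
      "b (n + Suc (Suc m)) i - a (n + Suc (Suc m)) i \<le> (1 + c) / 2 * (b (n + Suc m) h - a (n + Suc m) h)"
    by auto
  obtain j where j: "j \<in> K n" "a n j \<le> a (n + Suc m) h" "b (n + Suc m) h \<le> b n j"
      "b (n + Suc m) h - a (n + Suc m) h \<le> ((1 + c) / 2) ^ Suc m * (b n j - a n j)"
      "b (n + Suc m) h \<le> l n j \<or> r n j \<le> a (n + Suc m) h"
    using Suc.IH[OF h(1)] by blast
  have "(1 + c) / 2 * (b (n + Suc m) h - a (n + Suc m) h) \<le> (1 + c) / 2 * (((1 + c) / 2) ^ Suc m * (b n j - a n j))"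
    using j c by (intro mult_left_mono) auto
  then have "b (n + Suc (Suc m)) i - a (n + Suc (Suc m)) i \<le> ((1 + c) / 2) ^ Suc (Suc m) * (b n j - a n j)"
    using h by (simp only: power_Suc mult.assoc)
  then show ?case using h j by (intro bexI[of _ j]) auto
qed

section \<open>Choice of the exponent, the generations and the centres\<close>

theorem theorem2p1:
  fixes K :: "nat \<Rightarrow> 'i set" and a b l r :: "nat \<Rightarrow> 'i \<Rightarrow> real" and \<alpha> :: "nat \<Rightarrow> real"
  assumes "cantor_construction K a b l r"
    and "nice_construction K a b l r"
    and "porous_construction \<alpha> K a b l r"
    and "\<forall>n\<ge>1. 0 < \<alpha> n \<and> \<alpha> n < 1"
    and "\<exists>p::real. 0 < p \<and> \<not> summable (\<lambda>n. \<alpha> n powr p)"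
  shows "\<exists>\<mu>. doubling_measure \<mu> \<and> emeasure \<mu> (cantor_set K a b) = 0"
proof -
  note C = assms(1)
  obtain c where c: "0 < c" "c < 1" and nice: "\<And>n i. 1 \<le> n \<Longrightarrow> i \<in> K n \<Longrightarrow>
      {(a n i + b n i) / 2 - c * (b n i - a n i) / 2 ..
            (a n i + b n i) / 2 + c * (b n i - a n i) / 2} \<inter> Jop l r n i \<noteq> {}"
    using assms(2) unfolding nice_construction_def by blast
  have \<alpha>: "0 < \<alpha> n" "\<alpha> n < 1" if "1 \<le> n" for n using assms(4) that by auto
  have porous: "\<alpha> n * (b n i - a n i) \<le> r n i - l n i" if "1 \<le> n" "i \<in> K n" for n i
    using assms(3) that unfolding porous_construction_def by blast
  obtain p0 where p0: "0 < p0" "\<not> summable (\<lambda>n. \<alpha> n powr p0)" using assms(5) by blast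
  \<comment> \<open>The warp needs an exponent below 1; lowering it only enlarges the terms, as
    \<open>\<alpha> n < 1\<close>.\<close>
  define p where "p = min p0 (1 / 2)"
  have p: "0 < p" "p < 1" "p \<le> p0" using p0 by (auto simp: p_def)
  have nsp: "\<not> summable (\<lambda>n. \<alpha> (Suc n) powr p)"
  proof
    assume "summable (\<lambda>n. \<alpha> (Suc n) powr p)"
    then have "summable (\<lambda>n. \<alpha> n powr p)" using summable_Suc_iff[of "\<lambda>n. \<alpha> n powr p"] by simp
    moreover have "\<forall>n\<ge>1. norm (\<alpha> n powr p0) \<le> \<alpha> n powr p"
      using \<alpha> p by (auto intro!: powr_mono' simp: less_imp_le)
    ultimately have "summable (\<lambda>n. \<alpha> n powr p0)"
      by (rule summable_comparison_test[OF exI, rotated])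
    then show False using p0 by simp
  qed
  \<comment> \<open>The points of \<open>nice_interval\<close> are then \<open>12800 * d\<close>
    away from the ends, twice what \<open>central\<close> asks for, which leaves room to shift
    them.\<close>
  define \<delta> where "\<delta> = (1 - c) / 25600"
  have \<delta>: "0 < \<delta>" "\<delta> \<le> 1 / 12800" "(1 - c) / 2 = 12800 * \<delta>" using c by (auto simp: \<delta>_def)
  obtain m0 where m0: "((1 + c) / 2) ^ m0 < \<delta>" using real_arch_pow_inv[of \<delta> "(1 + c) / 2"] \<delta> c by auto
  define m where "m = Suc m0"
  have m: "((1 + c) / 2) ^ m \<le> \<delta>"
  proof -
    have "(1 + c) / 2 * ((1 + c) / 2) ^ m0 \<le> 1 * ((1 + c) / 2) ^ m0" using c by (intro mult_right_mono) auto
    then show ?thesis using m0 by (simp add: m_def)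
  qed
  obtain j where j: "\<not> summable (\<lambda>n. \<alpha> (Suc (m * n + j)) powr p)"
    using summable_residue_classes[of m "\<lambda>n. \<alpha> (Suc n) powr p"] nsp by (auto simp: m_def)
  \<comment> \<open>The residue class with divergent series; its steps of length \<open>m\<close>
    shrink intervals by \<open>\<delta>\<close>, and \<open>Suc\<close> makes generations start from
    1.\<close>
  define N where "N n = Suc (m * n + j)" for n
  have N: "1 \<le> N n" "N (Suc n) = N n + Suc m0" for n by (auto simp: N_def m_def)
  note I = nice_interval[OF C nice]
  have "\<exists>z. 1 \<le> n \<and> i \<in> K n \<longrightarrow> l n i + \<alpha> n * (\<delta> * (b n i - a n i)) \<le> z \<and> z + \<alpha> n * (\<delta> * (b n i - a n i)) \<le> r n i \<and>
      a n i + 6400 * (\<delta> * (b n i - a n i)) \<le> z \<and> z + 6400 * (\<delta> * (b n i - a n i)) \<le> b n i" for n i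
  proof (cases "1 \<le> n \<and> i \<in> K n")
    case True
    then have ni: "1 \<le> n" "i \<in> K n" by auto
    define d where "d = \<delta> * (b n i - a n i)"
    define h where "h = \<alpha> n * d"
    have d: "0 < d" using I(1)[OF ni ni] \<delta> by (simp add: d_def)
    have h: "0 < h" "h < d" using \<alpha>[OF ni(1)] d by (auto simp: h_def)
    have "h = \<delta> * (\<alpha> n * (b n i - a n i))" by (simp add: h_def d_def)
    also have "\<dots> \<le> 1 / 12800 * (\<alpha> n * (b n i - a n i))"
      using \<delta> \<alpha>[OF ni(1)] I(1)[OF ni ni] by (intro mult_right_mono) auto
    also have "\<dots> \<le> 1 / 12800 * (r n i - l n i)" using porous[OF ni] by simp
    finally have hr: "2 * h \<le> r n i - l n i" using I(3)[OF ni ni] by simp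
    obtain z where z: "l n i < z" "z < r n i" "12800 * d \<le> z - a n i" "12800 * d \<le> b n i - z"
      using I(5)[OF ni ni] unfolding \<delta>(3) d_def by (auto simp: mult.assoc)
    \<comment> \<open>Clamping moves \<open>z\<close> by at most \<open>h < d\<close>, so the
      interval of radius \<open>h\<close> fits into the hole and the centre stays far from the
      ends.\<close>
    define w where "w = max (l n i + h) (min (r n i - h) z)"
    have "l n i + h \<le> w \<and> w + h \<le> r n i \<and> a n i + 6400 * d \<le> w \<and> w + 6400 * d \<le> b n i"
      using z h hr by (auto simp: w_def max_def min_def)
    then show ?thesis unfolding d_def h_def by blast
  qed auto
  then obtain z where z: "\<And>n i. 1 \<le> n \<Longrightarrow> i \<in> K n \<Longrightarrow>
      l n i + \<alpha> n * (\<delta> * (b n i - a n i)) \<le> z n i \<and> z n i + \<alpha> n * (\<delta> * (b n i - a n i)) \<le> r n i \<and>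
      a n i + 6400 * (\<delta> * (b n i - a n i)) \<le> z n i \<and> z n i + 6400 * (\<delta> * (b n i - a n i)) \<le> b n i"
    by metis
  from cantor_constructionD(5)[OF C]
  obtain R where R: "0 < R" "\<And>x. x \<in> (\<Union>i\<in>K 1. Icl a b 1 i) \<Longrightarrow> \<bar>x\<bar> \<le> R"
    unfolding bounded_pos by auto
  have bnd: "- R \<le> a n i \<and> b n i \<le> R" if ni: "1 \<le> n" "i \<in> K n" for n i
  proof -
    have base: "- R \<le> a 1 h \<and> b 1 h \<le> R" if "h \<in> K 1" for h
    proof -
      have "a 1 h < b 1 h" using I(1)[of 1 h] that by simp
      then have "a 1 h \<in> (\<Union>i\<in>K 1. Icl a b 1 i)" "b 1 h \<in> (\<Union>i\<in>K 1. Icl a b 1 i)"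
        using that by (auto simp: Icl_def intro!: bexI[of _ h])
      then show ?thesis using R(2)[of "a 1 h"] R(2)[of "b 1 h"] by linarith
    qed
    show ?thesis
    proof (cases "n = 1")
      case True
      then show ?thesis using base that by simp
    next
      case False
      \<comment> \<open>\<open>cantor_descendant\<close> counts \<open>Suc m\<close> steps from
        generation 1, hence \<open>m = n - 2\<close>.\<close>
      then have e: "n = 1 + Suc (n - 2)" using ni by simp
      then obtain h where "h \<in> K 1" "a 1 h \<le> a n i" "b n i \<le> b 1 h"
        using cantor_descendant[OF C c(1) nice, of 1 i "n - 2"] ni by auto
      then show ?thesis using base[of h] by linarith
    qed
  qed
  \<comment> \<open>Nodes carry their generation, since one index may name different intervals in
    different generations.\<close>
  define T where "T n = {N n} \<times> K (N n)" for n
  define lo where "lo v = a (fst v) (snd v)" for v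
  define hi where "hi v = b (fst v) (snd v)" for v
  define ctr where "ctr v = z (fst v) (snd v)" for v
  interpret sparse_cantor_tree T lo hi ctr \<delta> p R "\<lambda>n. \<alpha> (N n)"
  proof
    show "0 < p" "p < 1" "0 < \<delta>" "\<delta> \<le> 1 / 12800" "0 < R" using p \<delta> R by auto
    show "0 < \<alpha> (N n)" "\<alpha> (N n) < 1" for n using \<alpha> N by auto
    fix v n assume "v \<in> T n"
    then have v: "fst v = N n" "1 \<le> N n" "snd v \<in> K (N n)" using N by (auto simp: T_def)
    show "lo v < hi v" using I(1)[OF v(2,3) v(2,3)] by (simp add: lo_def hi_def v(1))
    show "lo v + 6400 * (\<delta> * (hi v - lo v)) \<le> ctr v" "ctr v + 6400 * (\<delta> * (hi v - lo v)) \<le> hi v"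
      using z[OF v(2,3)] by (auto simp: lo_def hi_def ctr_def v(1))
    show "- R \<le> lo v" "hi v \<le> R" using bnd[OF v(2,3)] by (auto simp: lo_def hi_def v(1))
  next
    fix v w n assume "v \<in> T n" "w \<in> T n" "v \<noteq> w"
    then have vw: "fst v = N n" "fst w = N n" "snd v \<in> K (N n)" "snd w \<in> K (N n)" "snd v \<noteq> snd w"
      by (auto simp: T_def)
    have "interior (Icl a b (N n) (snd v)) \<inter> interior (Icl a b (N n) (snd w)) = {}"
      using cantor_constructionD(1)[OF C] vw N(1)[of n] by blast
    then have "{lo v<..<hi v} \<inter> {lo w<..<hi w} = {}" by (simp add: Icl_def lo_def hi_def vw)
    moreover have "lo v < hi v" "lo w < hi w"
      using I(1)[OF N(1) vw(3) N(1) vw(3)] I(1)[OF N(1) vw(4) N(1) vw(4)] by (auto simp: lo_def hi_def vw)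
    ultimately show "hi v \<le> lo w \<or> hi w \<le> lo v"
      by (auto simp: greaterThanLessThan_empty_iff max_def min_def split: if_splits)
  next
    fix v n assume "v \<in> T (Suc n)"
    then have v: "fst v = N n + Suc m0" "snd v \<in> K (N n + Suc m0)" using N(2) by (auto simp: T_def)
    obtain h where h: "h \<in> K (N n)" "a (N n) h \<le> lo v" "hi v \<le> b (N n) h"
        "hi v - lo v \<le> ((1 + c) / 2) ^ m * (b (N n) h - a (N n) h)" "hi v \<le> l (N n) h \<or> r (N n) h \<le> lo v"
      using cantor_descendant[OF C c(1) nice N(1) v(2)] unfolding lo_def hi_def v(1) m_def by blast
    have "((1 + c) / 2) ^ m * (b (N n) h - a (N n) h) \<le> \<delta> * (b (N n) h - a (N n) h)"
      using m I(1)[OF N(1) h(1) N(1) h(1)] by (intro mult_right_mono) auto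
    then show "\<exists>w\<in>T n. lo w \<le> lo v \<and> hi v \<le> hi w \<and> hi v - lo v \<le> \<delta> * (hi w - lo w) \<and>
        (hi v \<le> ctr w - \<alpha> (N n) * (\<delta> * (hi w - lo w)) \<or> ctr w + \<alpha> (N n) * (\<delta> * (hi w - lo w)) \<le> lo v)"
      using h z[OF N(1) h(1)]
      by (intro bexI[of _ "(N n, h)"]) (auto simp: T_def lo_def[of "(N n, h)"] hi_def[of "(N n, h)"] ctr_def)
  qed
  have "emeasure (interval_measure G) (cantor_set K a b) = 0"
  proof (rule null_of_not_summable)
    show "\<not> summable (\<lambda>n. \<alpha> (N n) powr p)" using j by (simp add: N_def)
    show "cantor_set K a b \<subseteq> (\<Union>v\<in>T n. {lo v..hi v})" for n
    proof -
      have "cantor_set K a b \<subseteq> (\<Union>i\<in>K (N n). Icl a b (N n) i)"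
        using N(1)[of n] unfolding cantor_set_def by (intro INF_lower) auto
      also have "\<dots> \<subseteq> (\<Union>v\<in>T n. {lo v..hi v})"
        by (auto simp: T_def lo_def hi_def Icl_def)
      finally show ?thesis .
    qed
  qed
  then show ?thesis using doubling_measure_G by blast
qed

end
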